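(* Let $\Omega\subset\mathbb{R}^2$ be a bounded convex polygonal domain with quasi-uniform triangulations $\mathcal{T}_h$. With the spaces, operators and notation $\lesssim$ defined in the context, let $$\widetilde{\Pi}:=\Pi_G^{-1}\Pi_q^\dagger : V_q\to W,\qquad B:=\widetilde{\Pi}A_q^{-1}\widetilde{\Pi}^*: W'\to W .$$ Then: (a) $\kappa(BA_W)=\kappa(\widetilde{\Pi}A_q^{-1}\widetilde{\Pi}^*A_W)\lesssim 1$; (b) $\kappa(BA_{LE})\lesssim \lambda$, independent of the mesh size $h$.
   Context: Notation: $x\lesssim y$ means that there is a constant $C$, independent of the mesh size $h$, such that $x\le Cy$. (A separate symbol $\lesssim_\lambda$ is reserved for the case where the constant depends on the Lamé coefficient $\lambda$; it is not the symbol used in the claim.) $\mathcal{T}_h$ is a quasi-uniform triangulation of $\Omega$ into triangles, of mesh size $h$. $V_1$ is the space of continuous piecewise linear functions on $\mathcal{T}_h$, with nodal basis $\{\phi_i\}_{i=1}^n$, $\phi_i$ associated with the vertex $x_i=(x_{1,i},x_{2,i})$; $\psi_{k,i}(x)=\frac{x_k-x_{k,i}}{h}$. $\mathrm{RM}=\{x\mapsto a+b(-x_2,x_1): a\in\mathbb{R}^2, b\in\mathbb{R}\}$ is the space of rigid modes, and $$W=\mathcal{V}_\perp:=\Big\{u\in V_1^2:\ \int_\Omega u\cdot v\,dx=0\ \ \forall v\in\mathrm{RM}\Big\}.$$ With $\varepsilon_{ij}(u)=\frac12(\partial_j u_i+\partial_i u_j)$ and $\langle\cdot,\cdot\rangle_F$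 the Frobenius inner product, define on $W$ $$a_W(u,v)=\int_\Omega\langle\varepsilon(u),\varepsilon(v)\rangle_F\,dx,\qquad a_{LE}(u,v)=\int_\Omega\big(2\mu\langle\varepsilon(u),\varepsilon(v)\rangle_F+\lambda(\nabla\cdot u)(\nabla\cdot v)\big)dx,$$ where $\lambda=\frac{E\nu}{(1+\nu)(1-2\nu)}$ and $\mu=\frac{E}{2(1+\nu)}$ are the Lamé coefficients, $E$ is the Young modulus and $\nu$ the Poisson ratio, with $\nu$ away from $1/2$. $A_W,A_{LE}:W\to W'$ are the isomorphisms associated with $a_W$ and $a_{LE}$, i.e. $(A_Wu)(v)=a_W(u,v)$ and $(A_{LE}u)(v)=a_{LE}(u,v)$. For $u=(u_1,u_2)\in V_1^2$ with $u_k=\sum_i\alpha_{k,i}\phi_i$, put $\Pi_G u=\sum_{k=1}^2\sum_{i=1}^n\alpha_{k,i}\psi_{k,i}\phi_i$. The kernel of $\Pi_G$ on $V_1^2$ is $\mathrm{RM}$. $V^G:=\Pi_G(V_1^2)$ is the generalized finite element space with zero linear part, equipped with $a_G(u,v)=\int_\Omega\nabla u\cdot\nabla v\,dx$, which is an inner product on $V^G$; $\Pi_G:W\to V^G$ is a bijection. $V_q$ is the space of continuous piecewise quadratic scalar functions on $\mathcal{T}_h$, taken modulo constants, equipped with the inner product $a_q(u,v)=\int_\Omega\nabla u\cdot\nabla v\,dx$; $A_q:V_q\to V_q'$ is the associated isomorphism, $(A_qu)(v)=a_q(u,v)$. $\Pi_q:V^G\to V_q$ is the natural inclusion (each element of $V^G$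 is a continuous piecewise quadratic function), and $\Pi_q^\dagger:V_q\to V^G$ is its Hilbert adjoint: $a_q(\Pi_qu_G,v_q)=a_G(u_G,\Pi_q^\dagger v_q)$ for all $u_G\in V^G$, $v_q\in V_q$. Primes denote dual spaces, and $\widetilde{\Pi}^*:W'\to V_q'$ is the dual (transpose) of $\widetilde{\Pi}$. For an operator $M$ on $W$ that is self-adjoint and positive definite with respect to some inner product on $W$ (for $BA_W$ the inner product $a_W$, for $BA_{LE}$ the inner product $a_{LE}$), $\kappa(M)$ denotes the ratio of its largest to its smallest eigenvalue.
   Formalization: In (b), since κ ≥ 1 while λ can tend to 0 (or be ≤ 0), the bound is stated for 0 < ν < 1/2, E ≥ E0 > 0 and λ ≥ Λ > 0, with E0, Λ arbitrary; the constant depends on E0 and Λ but not on h, E, ν or λ. *)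

theory Defs
  imports "HOL-Analysis.Analysis"
begin

section \<open>Domain and meshes\<close>

definition convex_polygonal_domain :: "(real^2) set \<Rightarrow> bool" where
  "convex_polygonal_domain \<Omega> \<longleftrightarrow>
     open \<Omega> \<and> \<Omega> \<noteq> {} \<and> bounded \<Omega> \<and> convex \<Omega> \<and> polytope (closure \<Omega>)"

definition triangulation_of :: "(real^2) set \<Rightarrow> (real^2) set set \<Rightarrow> bool" where
  "triangulation_of \<Omega> \<T> \<longleftrightarrow>
     triangulation \<T> \<and> (\<forall>T\<in>\<T>. 2 simplex T) \<and> \<Union>\<T> = closure \<Omega>"

definition mesh_size :: "(real^2) set set \<Rightarrow> real" where
  "mesh_size \<T> = Max (diameter ` \<T>)"

text \<open>A quasi-uniform family: every triangle contains a disc whose radius is comparable to the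
  mesh size of its triangulation, with one constant for the whole family.\<close>

definition quasi_uniform_family :: "(real^2) set \<Rightarrow> (real^2) set set set \<Rightarrow> bool" where
  "quasi_uniform_family \<Omega> F \<longleftrightarrow>
     (\<forall>\<T>\<in>F. triangulation_of \<Omega> \<T>) \<and>
     (\<exists>\<rho>>0. \<forall>\<T>\<in>F. \<forall>T\<in>\<T>. \<exists>x. ball x (\<rho> * mesh_size \<T>) \<subseteq> T)"


section \<open>Differential operators\<close>

text \<open>The functions differentiated below are continuous and piecewise polynomial, so their weak
  derivatives are the classical ones away from the edges of the mesh. The edges are a null set,
  and the integrals are taken with respect to the (complete) Lebesgue measure, so the arbitrary
  values at points of non-differentiability do not matter.\<close>

definition partial_deriv :: "2 \<Rightarrow> (real^2 \<Rightarrow> real) \<Rightarrow> real^2 \<Rightarrow> real" where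
  "partial_deriv k f x = frechet_derivative f (at x) (axis k 1)"

definition grad :: "(real^2 \<Rightarrow> real) \<Rightarrow> real^2 \<Rightarrow> real^2" where
  "grad f x = (\<chi> k. partial_deriv k f x)"

definition strain :: "(real^2 \<Rightarrow> real^2) \<Rightarrow> real^2 \<Rightarrow> real^2^2" where
  "strain u x = (\<chi> i j. (partial_deriv j (\<lambda>y. u y $ i) x + partial_deriv i (\<lambda>y. u y $ j) x) / 2)"

definition divergence :: "(real^2 \<Rightarrow> real^2) \<Rightarrow> real^2 \<Rightarrow> real" where
  "divergence u x = (\<Sum>k\<in>UNIV. partial_deriv k (\<lambda>y. u y $ k) x)"

definition frobenius :: "real^2^2 \<Rightarrow> real^2^2 \<Rightarrow> real" where
  "frobenius A B = (\<Sum>i\<in>UNIV. \<Sum>j\<in>UNIV. A $ i $ j * B $ i $ j)"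

definition rigid_modes :: "(real^2 \<Rightarrow> real^2) set" where
  "rigid_modes = {v. \<exists>a b. v = (\<lambda>x. a + b *\<^sub>R vector [- (x $ 2), x $ 1])}"

definition lame_lambda :: "real \<Rightarrow> real \<Rightarrow> real" where
  "lame_lambda E \<nu> = E * \<nu> / ((1 + \<nu>) * (1 - 2 * \<nu>))"

definition lame_mu :: "real \<Rightarrow> real \<Rightarrow> real" where
  "lame_mu E \<nu> = E / (2 * (1 + \<nu>))"


section \<open>Operators on spaces given by carrier sets\<close>

text \<open>A functional on the space with carrier \<open>V\<close> is a function that is \<open>undefined\<close> outside \<open>V\<close>
  (an element of \<open>extensional V\<close>), so that functionals on \<open>V\<close> are equal iff they agree on \<open>V\<close>.\<close>

definition form_operator :: "'a set \<Rightarrow> ('a \<Rightarrow> 'a \<Rightarrow> real) \<Rightarrow> 'a \<Rightarrow> ('a \<Rightarrow> real)" where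
  "form_operator V a u = (\<lambda>v\<in>V. a u v)"

definition dual_map :: "'a set \<Rightarrow> ('a \<Rightarrow> 'b) \<Rightarrow> ('b \<Rightarrow> real) \<Rightarrow> ('a \<Rightarrow> real)" where
  "dual_map V P \<phi> = (\<lambda>v\<in>V. \<phi> (P v))"

definition hilbert_adjoint ::
  "'a set \<Rightarrow> ('a \<Rightarrow> 'a \<Rightarrow> real) \<Rightarrow> ('b \<Rightarrow> 'b \<Rightarrow> real) \<Rightarrow> ('a \<Rightarrow> 'b) \<Rightarrow> 'b \<Rightarrow> 'a" where
  "hilbert_adjoint U a b P v = (THE w. w \<in> U \<and> (\<forall>u\<in>U. b (P u) v = a u w))"

definition eigenvalues ::
  "(real^2 \<Rightarrow> real^2) set \<Rightarrow> ((real^2 \<Rightarrow> real^2) \<Rightarrow> (real^2 \<Rightarrow> real^2)) \<Rightarrow> real set" where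
  "eigenvalues V M = {c. \<exists>u\<in>V. u \<noteq> (\<lambda>x. 0) \<and> M u = (\<lambda>x. c *\<^sub>R u x)}"

definition condition_number ::
  "(real^2 \<Rightarrow> real^2) set \<Rightarrow> ((real^2 \<Rightarrow> real^2) \<Rightarrow> (real^2 \<Rightarrow> real^2)) \<Rightarrow> real" where
  "condition_number V M = Max (eigenvalues V M) / Min (eigenvalues V M)"


section \<open>Finite element spaces\<close>

context
  fixes \<Omega> :: "(real^2) set" and \<T> :: "(real^2) set set"
begin

text \<open>Functions on the closed domain are represented by their extension by zero to the plane.\<close>

definition V1 :: "(real^2 \<Rightarrow> real) set" where
  "V1 = {f. continuous_on (closure \<Omega>) f \<and> (\<forall>x. x \<notin> closure \<Omega> \<longrightarrow> f x = 0) \<and>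
           (\<forall>T\<in>\<T>. \<exists>a b. \<forall>x\<in>T. f x = a + b \<bullet> x)}"

definition P2 :: "(real^2 \<Rightarrow> real) set" where
  "P2 = {f. continuous_on (closure \<Omega>) f \<and> (\<forall>x. x \<notin> closure \<Omega> \<longrightarrow> f x = 0) \<and>
           (\<forall>T\<in>\<T>. \<exists>a b A. \<forall>x\<in>T. f x = a + b \<bullet> x + x \<bullet> (A *v x))}"

definition V1_vec :: "(real^2 \<Rightarrow> real^2) set" where
  "V1_vec = {u. \<forall>k. (\<lambda>x. u x $ k) \<in> V1}"

definition W_perp :: "(real^2 \<Rightarrow> real^2) set" where
  "W_perp = {u \<in> V1_vec. \<forall>v\<in>rigid_modes. (LINT x:\<Omega>|lebesgue. u x \<bullet> v x) = 0}"

definition a_W :: "(real^2 \<Rightarrow> real^2) \<Rightarrow> (real^2 \<Rightarrow> real^2) \<Rightarrow> real" where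
  "a_W u v = (LINT x:\<Omega>|lebesgue. frobenius (strain u x) (strain v x))"

definition a_LE :: "real \<Rightarrow> real \<Rightarrow> (real^2 \<Rightarrow> real^2) \<Rightarrow> (real^2 \<Rightarrow> real^2) \<Rightarrow> real" where
  "a_LE E \<nu> u v = (LINT x:\<Omega>|lebesgue.
     2 * lame_mu E \<nu> * frobenius (strain u x) (strain v x)
       + lame_lambda E \<nu> * divergence u x * divergence v x)"

definition A_W :: "(real^2 \<Rightarrow> real^2) \<Rightarrow> ((real^2 \<Rightarrow> real^2) \<Rightarrow> real)" where
  "A_W = form_operator W_perp a_W"

definition A_LE :: "real \<Rightarrow> real \<Rightarrow> (real^2 \<Rightarrow> real^2) \<Rightarrow> ((real^2 \<Rightarrow> real^2) \<Rightarrow> real)" where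
  "A_LE E \<nu> = form_operator W_perp (a_LE E \<nu>)"


subsection \<open>Nodal basis and the generalized finite element space\<close>

definition vertices :: "(real^2) set" where
  "vertices = {p. \<exists>T\<in>\<T>. p extreme_point_of T}"

definition nodal_basis :: "real^2 \<Rightarrow> (real^2 \<Rightarrow> real)" where
  "nodal_basis p = (THE f. f \<in> V1 \<and> (\<forall>q\<in>vertices. f q = (if q = p then 1 else 0)))"

definition nodal_coeff :: "(real^2 \<Rightarrow> real) \<Rightarrow> real^2 \<Rightarrow> real" where
  "nodal_coeff f = (THE \<alpha>. (\<forall>p. p \<notin> vertices \<longrightarrow> \<alpha> p = 0) \<and>
                           f = (\<lambda>x. \<Sum>p\<in>vertices. \<alpha> p * nodal_basis p x))"

definition psi :: "2 \<Rightarrow> real^2 \<Rightarrow> (real^2 \<Rightarrow> real)" where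
  "psi k p x = (x $ k - p $ k) / mesh_size \<T>"

definition Pi_G :: "(real^2 \<Rightarrow> real^2) \<Rightarrow> (real^2 \<Rightarrow> real)" where
  "Pi_G u = (\<lambda>x. \<Sum>k\<in>UNIV. \<Sum>p\<in>vertices.
                nodal_coeff (\<lambda>y. u y $ k) p * psi k p x * nodal_basis p x)"

definition V_G :: "(real^2 \<Rightarrow> real) set" where
  "V_G = Pi_G ` V1_vec"

definition a_G :: "(real^2 \<Rightarrow> real) \<Rightarrow> (real^2 \<Rightarrow> real) \<Rightarrow> real" where
  "a_G u v = (LINT x:\<Omega>|lebesgue. grad u x \<bullet> grad v x)"


subsection \<open>Quadratic elements modulo constants\<close>

definition mod_const :: "((real^2 \<Rightarrow> real) \<times> (real^2 \<Rightarrow> real)) set" where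
  "mod_const = {(f, g). f \<in> P2 \<and> g \<in> P2 \<and> (\<exists>c. \<forall>x\<in>closure \<Omega>. g x = f x + c)}"

definition V_q :: "(real^2 \<Rightarrow> real) set set" where
  "V_q = P2 // mod_const"

text \<open>The value does not depend on the chosen representatives, as they differ by constants.\<close>

definition a_q :: "(real^2 \<Rightarrow> real) set \<Rightarrow> (real^2 \<Rightarrow> real) set \<Rightarrow> real" where
  "a_q U V = (LINT x:\<Omega>|lebesgue. grad (SOME f. f \<in> U) x \<bullet> grad (SOME g. g \<in> V) x)"

definition A_q :: "(real^2 \<Rightarrow> real) set \<Rightarrow> ((real^2 \<Rightarrow> real) set \<Rightarrow> real)" where
  "A_q = form_operator V_q a_q"

definition Pi_q :: "(real^2 \<Rightarrow> real) \<Rightarrow> (real^2 \<Rightarrow> real) set" where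
  "Pi_q u = mod_const `` {u}"

definition Pi_q_adj :: "(real^2 \<Rightarrow> real) set \<Rightarrow> (real^2 \<Rightarrow> real)" where
  "Pi_q_adj = hilbert_adjoint V_G a_G a_q Pi_q"


subsection \<open>The preconditioner\<close>

definition Pi_tilde :: "(real^2 \<Rightarrow> real) set \<Rightarrow> (real^2 \<Rightarrow> real^2)" where
  "Pi_tilde = inv_into W_perp Pi_G \<circ> Pi_q_adj"

definition precond_B :: "((real^2 \<Rightarrow> real^2) \<Rightarrow> real) \<Rightarrow> (real^2 \<Rightarrow> real^2)" where
  "precond_B = Pi_tilde \<circ> inv_into V_q A_q \<circ> dual_map V_q Pi_tilde"

end

end

theory Submission
  imports Defs "HOL-Library.Function_Algebras"
begin

text \<open>
  Write \<open>\<Pi>\<close> for \<open>Pi_G\<close> and \<open>h\<close> for the mesh size. The proof has an algebraic half and an analytic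
  half.

  Algebra. The adjoint of the inclusion of \<open>V_G\<close> into the quadratic elements is a projection, so
  the quadratic space disappears from the preconditioned operator: if \<open>A\<close> comes from a symmetric
  form \<open>a\<close> on \<open>W\<close>, then \<open>B A u\<close> is the element \<open>z\<close> of \<open>W\<close> with
  \<open>a_G (\<Pi> z) (\<Pi> w) = a u w\<close> for all \<open>w\<close> in \<open>W\<close> (\<open>precond_B\<close>). Hence every eigenvalue is a quotient
  \<open>a u u / a_G (\<Pi> u) (\<Pi> u)\<close>, and \<open>condition_number_le\<close> reduces the theorem to an equivalence of
  quadratic forms whose constants depend only on the shape parameter \<open>\<rho>\<close>.

  Analysis. Summing the defining formula of \<open>\<Pi>\<close> gives \<open>\<Pi> u = (u \<bullet> x - I (u \<bullet> x)) / h\<close> with the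
  nodal interpolation operator \<open>I\<close>. On a triangle where \<open>u = a + M x\<close> this is \<open>1/h\<close> times the
  interpolation error of the quadratic form of \<open>\<epsilon>\<close>, the symmetric part of \<open>M\<close>, and \<open>\<epsilon>\<close> is exactly
  the strain of \<open>u\<close>. The gradient of \<open>\<Pi> u\<close> is therefore \<open>(g + 2 \<epsilon> x) / h\<close> with a constant vector
  \<open>g\<close>. It is at most a constant times \<open>\<epsilon>\<close> because the error vanishes at the three vertices of a
  triangle that is not too thin (\<open>quadratic_gradient_upper\<close>), and it cannot be small on the whole
  triangle because it varies at the rate \<open>2 \<epsilon> / h\<close> (\<open>affine_field_lower\<close>). The comparison of
  \<open>a_G (\<Pi> u) (\<Pi> u)\<close> with \<open>a_W u u\<close> is thus local, triangle by triangle (\<open>a_G_Pi_G_le\<close>,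
  \<open>a_W_le_a_G\<close>). For elasticity the square of the trace of \<open>\<epsilon>\<close> is at most
  twice its squared norm, so \<open>a_LE\<close> lies between \<open>2 \<mu> a_W\<close> and \<open>(2 \<mu> + 2 \<lambda>) a_W\<close>.

  It remains to see that \<open>a_G (\<Pi> u) (\<Pi> u)\<close> is definite on \<open>W\<close>. If it vanishes, so does the strain,
  and a continuous piecewise affine field without strain on a convex domain is rigid
  (\<open>strain_zero_rigid\<close>); a rigid field orthogonal to all rigid fields is zero.
\<close>

section \<open>Inner products on finite-dimensional spaces of functions\<close>

text \<open>The finite element spaces are sets of functions; with the pointwise vector space structure,
  subspaces, spans and dimension bounds become available for them.\<close>
instantiation "fun" :: (type, real_vector) real_vector
begin

definition scaleR_fun_def: "c *\<^sub>R f = (\<lambda>x. c *\<^sub>R f x)"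

instance
  by standard (simp_all add: scaleR_fun_def fun_eq_iff algebra_simps)

end

lemma scaleR_fun_apply [simp]: "(c *\<^sub>R f) x = c *\<^sub>R f x"
  by (simp add: scaleR_fun_def)

text \<open>The bilinear forms below are integrals, which behave linearly only on integrable arguments.
  An inner product is therefore required on a subspace only, not on the whole type.\<close>
locale inner_on =
  fixes V :: "'v::real_vector set" and b :: "'v \<Rightarrow> 'v \<Rightarrow> real"
  assumes subspace: "subspace V"
    and add: "\<And>x y z. \<lbrakk>x \<in> V; y \<in> V; z \<in> V\<rbrakk> \<Longrightarrow> b (x + y) z = b x z + b y z"
    and scale: "\<And>c x z. \<lbrakk>x \<in> V; z \<in> V\<rbrakk> \<Longrightarrow> b (c *\<^sub>R x) z = c * b x z"
    and sym: "\<And>x y. \<lbrakk>x \<in> V; y \<in> V\<rbrakk> \<Longrightarrow> b x y = b y x"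
    and pos: "\<And>x. \<lbrakk>x \<in> V; x \<noteq> 0\<rbrakk> \<Longrightarrow> b x x > 0"
begin

lemma zero: "x \<in> V \<Longrightarrow> b 0 x = 0"
  using scale[of x x 0] by simp

lemma diff: "\<lbrakk>x \<in> V; y \<in> V; z \<in> V\<rbrakk> \<Longrightarrow> b (x - y) z = b x z - b y z"
  using add[of x "(-1) *\<^sub>R y" z] scale[of y z "-1"] subspace
  by (simp add: subspace_neg)

lemma unique:
  assumes "x \<in> V" "y \<in> V" "\<And>z. z \<in> V \<Longrightarrow> b x z = b y z"
  shows "x = y"
proof -
  have "x - y \<in> V" using assms subspace by (simp add: subspace_diff)
  then show ?thesis using pos[of "x - y"] diff[of x y "x - y"] assms by force
qed

text \<open>The induction on a spanning set is Gram--Schmidt: the representer on the smaller span is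
  corrected along the component of the new vector orthogonal to that span.\<close>

lemma riesz_span:
  assumes "finite B" "span B \<subseteq> V"
    and "\<And>x y. \<lbrakk>x \<in> V; y \<in> V\<rbrakk> \<Longrightarrow> l (x + y) = l x + l y"
    and "\<And>c x. x \<in> V \<Longrightarrow> l (c *\<^sub>R x) = c * l x"
  shows "\<exists>w\<in>span B. \<forall>v\<in>span B. b w v = (l v :: real)"
  using assms
proof (induction B arbitrary: l rule: finite_induct)
  case empty
  have "l 0 = 0" using empty(3)[of 0 0] subspace by (simp add: subspace_0)
  moreover have "b 0 0 = 0" using zero[of 0] subspace by (simp add: subspace_0)
  ultimately show ?case by simp
next
  case (insert p B)
  have SB: "span B \<subseteq> span (insert p B)" by (simp add: span_mono subset_insertI)
  with insert.prems(1) have BV: "span B \<subseteq> V" by blast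
  have pV: "p \<in> V" using insert.prems(1) span_base[of p "insert p B"] by blast
  obtain w where w: "w \<in> span B" "\<And>v. v \<in> span B \<Longrightarrow> b w v = l v"
    using insert.IH[OF BV, of l] insert.prems by blast
  have wV: "w \<in> V" using w BV by blast
  obtain g where g: "g \<in> span B" "\<And>v. v \<in> span B \<Longrightarrow> b g v = b p v"
  proof -
    have "\<exists>g\<in>span B. \<forall>v\<in>span B. b g v = b v p"
      using insert.IH[OF BV, of "\<lambda>v. b v p"] add scale pV by blast
    then show ?thesis using that sym pV BV by (metis subsetD)
  qed
  have gV: "g \<in> V" using g BV by blast
  define n where "n = p - g"
  have nV: "n \<in> V" using pV gV subspace by (simp add: n_def subspace_diff)
  have orth: "b n v = 0" if "v \<in> span B" for v
    using that g diff[of p g v] pV gV BV by (auto simp: n_def)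
  show ?case
  proof (cases "n = 0")
    case True
    then have "p \<in> span B" using g by (simp add: n_def)
    then have "span (insert p B) = span B" by (rule span_redundant)
    then show ?thesis using w by auto
  next
    case False
    then have npos: "b n n > 0" using pos nV by blast
    define k where "k = (l n - b w n) / b n n"
    have kb: "k * b n n = l n - b w n" using npos by (simp add: k_def)
    have nS: "n \<in> span (insert p B)"
      unfolding n_def using g SB by (meson insertI1 span_base span_diff subsetD)
    have kn: "k *\<^sub>R n \<in> V" using nV subspace by (simp add: subspace_scale)
    show ?thesis
    proof (intro bexI[of _ "w + k *\<^sub>R n"] ballI)
      show "w + k *\<^sub>R n \<in> span (insert p B)"
        using w SB nS by (meson span_add span_scale subsetD)
      fix v assume "v \<in> span (insert p B)"
      then obtain t where "v - t *\<^sub>R p \<in> span B" by (auto simp: span_breakdown_eq)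
      then have "(v - t *\<^sub>R p) + t *\<^sub>R g \<in> span B" using g by (meson span_add span_scale)
      then have v0: "v - t *\<^sub>R n \<in> span B" by (simp add: n_def algebra_simps)
      define v0 where "v0 = v - t *\<^sub>R n"
      have v0': "v0 \<in> span B" "v0 \<in> V" "v = v0 + t *\<^sub>R n" using v0 BV by (auto simp: v0_def)
      have tn: "t *\<^sub>R n \<in> V" using nV subspace by (simp add: subspace_scale)
      have vV: "v \<in> V" using v0' tn subspace by (simp add: subspace_add)
      have "b n v = t * b n n"
        using sym[of n v] add[of v0 "t *\<^sub>R n" n] scale[of n n t] sym[of v0 n] orth v0' nV tn vV
        by simp
      moreover have "b w v = l v0 + t * b w n"
        using sym[of w v] add[of v0 "t *\<^sub>R n" w] scale[of n w t] sym[of v0 w] sym[of n w] w v0' nV tn vV wV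
        by simp
      moreover have "l v = l v0 + t * l n"
        using insert.prems(2)[of v0 "t *\<^sub>R n"] insert.prems(3)[of n t] v0' tn nV by simp
      ultimately show "b (w + k *\<^sub>R n) v = l v"
        using add[of w "k *\<^sub>R n" v] scale[of n v k] wV kn vV nV arg_cong[OF kb, of "\<lambda>y. t * y"]
        by (simp add: algebra_simps)
    qed
  qed
qed

end

locale finite_dim_inner_on = inner_on +
  assumes finite_dim: "\<exists>B. finite B \<and> V \<subseteq> span B"
begin

lemma finite_basis:
  obtains B where "finite B" "span B = V"
proof -
  obtain C where C: "finite C" "V \<subseteq> span C" using finite_dim by blast
  obtain B where B: "B \<subseteq> V" "independent B" "V \<subseteq> span B" using basis_exists[of V] by metis
  then have "finite B" using C independent_span_bound[of C B] by (meson order.trans)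
  moreover have "span B = V" using B subspace by (meson span_minimal subset_antisym)
  ultimately show ?thesis using that by blast
qed

lemma riesz:
  assumes "\<And>x y. \<lbrakk>x \<in> V; y \<in> V\<rbrakk> \<Longrightarrow> l (x + y) = l x + l y"
    and "\<And>c x. x \<in> V \<Longrightarrow> l (c *\<^sub>R x) = c * l x"
  obtains w where "w \<in> V" "\<And>v. v \<in> V \<Longrightarrow> b w v = (l v :: real)"
proof -
  obtain B where B: "finite B" "span B = V" by (rule finite_basis)
  have "span B \<subseteq> V" using B by simp
  from riesz_span[OF B(1) this, of l] assms B(2) that show ?thesis by metis
qed

text \<open>Eigenvectors of a self-adjoint operator for distinct eigenvalues are orthogonal, hence
  independent, and a finite-dimensional space has room for finitely many of them only.\<close>

lemma finite_eigenvalues: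
  assumes M: "\<And>u v. \<lbrakk>u \<in> V; v \<in> V\<rbrakk> \<Longrightarrow> b (M u) v = a u v"
    and asym: "\<And>u v. \<lbrakk>u \<in> V; v \<in> V\<rbrakk> \<Longrightarrow> a u v = a v u"
  shows "finite {c. \<exists>u\<in>V. u \<noteq> 0 \<and> M u = c *\<^sub>R u}" (is "finite ?E")
proof -
  define e where "e c = (SOME u. u \<in> V \<and> u \<noteq> 0 \<and> M u = c *\<^sub>R u)" for c
  have e: "e c \<in> V \<and> e c \<noteq> 0 \<and> M (e c) = c *\<^sub>R e c" if "c \<in> ?E" for c
    unfolding e_def by (rule someI_ex) (use that in blast)
  have orth: "b (e c) (e d) = 0" if "c \<in> ?E" "d \<in> ?E" "c \<noteq> d" for c d
  proof -
    have "c * b (e c) (e d) = a (e c) (e d)"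
      using M[of "e c" "e d"] scale[of "e c" "e d" c] e[OF that(1)] e[OF that(2)] by auto
    moreover have "d * b (e d) (e c) = a (e d) (e c)"
      using M[of "e d" "e c"] scale[of "e d" "e c" d] e[OF that(1)] e[OF that(2)] by auto
    ultimately have "c * b (e c) (e d) = d * b (e c) (e d)"
      using asym[of "e c" "e d"] sym[of "e c" "e d"] e[OF that(1)] e[OF that(2)] by simp
    then show ?thesis using that(3) by simp
  qed
  have inj: "inj_on e ?E"
  proof (rule inj_onI, rule ccontr)
    fix c d assume *: "c \<in> ?E" "d \<in> ?E" "e c = e d" "c \<noteq> d"
    then have "b (e c) (e c) = 0" using orth[of c d] by simp
    then show False using pos[of "e c"] e[OF *(1)] by simp
  qed
  have zero_span: "b v x = 0" if "x \<in> span S" "S \<subseteq> V" "v \<in> V" "\<And>s. s \<in> S \<Longrightarrow> b v s = 0" for x S v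
  proof -
    have "subspace {x \<in> V. b x v = 0}"
      using subspace zero[OF that(3)] add[OF _ _ that(3)] scale[OF _ that(3)]
      by (simp add: subspace_def)
    moreover have "S \<subseteq> {x \<in> V. b x v = 0}"
    proof
      fix s assume "s \<in> S"
      with that(2,4) sym[OF that(3), of s] show "s \<in> {x \<in> V. b x v = 0}" by auto
    qed
    ultimately have "x \<in> {x \<in> V. b x v = 0}" using that(1) span_minimal by blast
    then show ?thesis using sym[OF that(3)] by simp
  qed
  have indep: "independent (e ` ?E)"
    unfolding dependent_def
  proof clarify
    fix c u
    assume u: "u \<in> V" "u \<noteq> 0" "M u = c *\<^sub>R u" and "e c \<in> span (e ` ?E - {e c})"
    then have c: "c \<in> ?E" by blast
    have "b (e c) (e c) = 0"
    proof (rule zero_span[OF \<open>e c \<in> span _\<close>])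
      show "e ` ?E - {e c} \<subseteq> V" "e c \<in> V" using e c by blast+
      fix s assume "s \<in> e ` ?E - {e c}"
      then obtain d where "d \<in> ?E" "s = e d" "d \<noteq> c" by blast
      then show "b (e c) s = 0" using orth c by blast
    qed
    then show False using pos[of "e c"] e[OF c] by simp
  qed
  obtain B where B: "finite B" "span B = V" by (rule finite_basis)
  have "e ` ?E \<subseteq> span B" unfolding B(2) using e by blast
  then have "finite (e ` ?E)"
    by (rule independent_span_bound[THEN conjunct1, OF B(1) indep])
  then show ?thesis using inj finite_imageD by blast
qed

end

text \<open>The factor \<open>\<bar>Max {} / Min {}\<bar>\<close> accounts for the unspecified value that the condition
  number takes when there are no eigenvalues, that is, on the zero space.\<close>

lemma condition_number_le:
  fixes M :: "(real^2 \<Rightarrow> real^2) \<Rightarrow> (real^2 \<Rightarrow> real^2)"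
  assumes "finite_dim_inner_on V b"
    and M: "\<And>u v. \<lbrakk>u \<in> V; v \<in> V\<rbrakk> \<Longrightarrow> b (M u) v = a u v"
    and asym: "\<And>u v. \<lbrakk>u \<in> V; v \<in> V\<rbrakk> \<Longrightarrow> a u v = a v u"
    and lower: "\<And>u. u \<in> V \<Longrightarrow> c1 * b u u \<le> a u u"
    and upper: "\<And>u. u \<in> V \<Longrightarrow> a u u \<le> c2 * b u u"
    and "0 < c1"
  shows "condition_number V M \<le> max \<bar>Max {} / Min {}\<bar> (c2 / c1)"
proof -
  interpret finite_dim_inner_on V b by fact
  have E: "eigenvalues V M = {c. \<exists>u\<in>V. u \<noteq> 0 \<and> M u = c *\<^sub>R u}"
    by (simp add: eigenvalues_def scaleR_fun_def zero_fun_def)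
  have fin: "finite (eigenvalues V M)" unfolding E using M asym by (rule finite_eigenvalues)
  have bounds: "c1 \<le> c \<and> c \<le> c2" if c: "c \<in> eigenvalues V M" for c
  proof -
    obtain u where u: "u \<in> V" "u \<noteq> 0" "M u = c *\<^sub>R u" using c unfolding E by blast
    then have "a u u = c * b u u" using M[of u u] scale[of u u c] by simp
    then show ?thesis using lower[OF u(1)] upper[OF u(1)] pos[OF u(1,2)]
      by (auto simp: mult_le_cancel_right)
  qed
  show ?thesis
  proof (cases "eigenvalues V M = {}")
    case True
    have "Max {} / Min {} \<le> \<bar>Max {} / Min {} :: real\<bar>" by (rule abs_ge_self)
    with True show ?thesis unfolding condition_number_def by simp
  next
    case False
    then have "Max (eigenvalues V M) \<in> eigenvalues V M" "Min (eigenvalues V M) \<in> eigenvalues V M"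
      using fin by auto
    then have "Max (eigenvalues V M) / Min (eigenvalues V M) \<le> c2 / c1"
      using bounds \<open>0 < c1\<close> by (intro frac_le) fastforce+
    then show ?thesis by (simp add: condition_number_def)
  qed
qed

section \<open>Triangulations and nodal interpolation\<close>

text \<open>The edge vectors at one corner are linearly independent, so a linear functional can be
  prescribed on them.\<close>
lemma affine_interpolant:
  fixes C :: "'a::euclidean_space set"
  assumes "\<not> affine_dependent C"
  shows "\<exists>a b. \<forall>p\<in>C. a + b \<bullet> p = (val p :: real)"
proof (cases "C = {}")
  case False
  then obtain p0 where p0: "p0 \<in> C" by blast
  let ?B = "(\<lambda>x. - p0 + x) ` (C - {p0})"
  have "independent ?B" using affine_dependent_iff_dependent2[OF p0] assms by simp
  then obtain g where g: "linear g" "\<forall>x\<in>?B. g x = val (x + p0) - val p0"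
    using linear_independent_extend[of ?B "\<lambda>x. val (x + p0) - val p0"] by blast
  define b where "b = adjoint g 1"
  have b: "b \<bullet> x = g x" for x
    using adjoint_works[OF g(1), of x 1] by (simp add: b_def inner_commute)
  have "(val p0 - b \<bullet> p0) + b \<bullet> p = val p" if "p \<in> C" for p
  proof (cases "p = p0")
    case False
    then have "g (- p0 + p) = val (- p0 + p + p0) - val p0" using g(2) that by blast
    then show ?thesis using b[of "- p0 + p"] by (simp add: inner_diff_right)
  qed simp
  then show ?thesis by blast
qed simp

lemma affine_eq_on_convex_hull:
  fixes b b' :: "'a::real_inner"
  assumes "\<And>p. p \<in> S \<Longrightarrow> a + b \<bullet> p = a' + b' \<bullet> p" and "x \<in> convex hull S"
  shows "a + b \<bullet> x = a' + b' \<bullet> x"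
proof -
  have "convex hull S \<subseteq> {x. (b - b') \<bullet> x = a' - a}"
    using assms(1) by (intro hull_minimal convex_hyperplane) (force simp: inner_diff_left)
  then show ?thesis using assms(2) by (auto simp: inner_diff_left)
qed

definition corners :: "'a::real_vector set \<Rightarrow> 'a set" where
  "corners T = {p. p extreme_point_of T}"

text \<open>One member of a quasi-uniform family; the family provides the same \<open>\<rho>\<close> for all of them.\<close>
locale shape_regular_mesh =
  fixes \<Omega> :: "(real^2) set" and \<T> :: "(real^2) set set" and \<rho> :: real
  assumes domain: "convex_polygonal_domain \<Omega>"
    and triangulation: "triangulation_of \<Omega> \<T>"
    and rho_pos: "0 < \<rho>"
    and balls: "\<And>T. T \<in> \<T> \<Longrightarrow> \<exists>x. ball x (\<rho> * mesh_size \<T>) \<subseteq> T"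
begin

abbreviation h where "h \<equiv> mesh_size \<T>"

lemma open_domain: "open \<Omega>" and convex_domain: "convex \<Omega>"
  and domain_nonempty: "\<Omega> \<noteq> {}"
  using domain by (auto simp: convex_polygonal_domain_def)

lemma interior_closure_domain: "interior (closure \<Omega>) = \<Omega>"
  using convex_domain open_domain domain_nonempty
  by (simp add: convex_interior_closure interior_open)

lemma finite_mesh: "finite \<T>"
  using triangulation by (auto simp: triangulation_of_def triangulation_def)

lemma Union_mesh: "\<Union>\<T> = closure \<Omega>"
  using triangulation by (simp add: triangulation_of_def)

lemma mesh_cover: "x \<in> closure \<Omega> \<Longrightarrow> \<exists>T\<in>\<T>. x \<in> T"
  using Union_mesh by blast

lemma triangle_subset: "T \<in> \<T> \<Longrightarrow> T \<subseteq> closure \<Omega>"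
  using Union_mesh by blast

lemma triangle_simplex:
  assumes "T \<in> \<T>"
  shows "finite (corners T)" "\<not> affine_dependent (corners T)" "card (corners T) = 3"
    "convex hull (corners T) = T"
proof -
  from triangulation assms have "2 simplex T" by (simp add: triangulation_of_def)
  then obtain C where C: "finite C" "\<not> affine_dependent C" "int (card C) = 2 + 1" "T = convex hull C"
    unfolding simplex by blast
  then have "corners T = C"
    by (simp add: corners_def extreme_point_of_convex_hull_affine_independent)
  with C show "finite (corners T)" "\<not> affine_dependent (corners T)" "card (corners T) = 3"
    "convex hull (corners T) = T" by auto
qed

lemma corners_subset: "T \<in> \<T> \<Longrightarrow> corners T \<subseteq> T"
  using triangle_simplex(4)[of T] hull_subset[of "corners T" convex] by simp

lemma corners_nonempty: "T \<in> \<T> \<Longrightarrow> corners T \<noteq> {}"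
  using triangle_simplex(3)[of T] by auto

lemma compact_triangle: "T \<in> \<T> \<Longrightarrow> compact T"
  using triangle_simplex[of T] finite_imp_compact_convex_hull by metis

lemma convex_triangle: "T \<in> \<T> \<Longrightarrow> convex T"
  using triangle_simplex(4)[of T] convex_convex_hull by metis

lemma vertices_eq: "vertices \<T> = (\<Union>T\<in>\<T>. corners T)"
  by (auto simp: vertices_def corners_def)

lemma finite_vertices: "finite (vertices \<T>)"
  using finite_mesh triangle_simplex(1) by (simp add: vertices_eq)

lemma corners_vertices: "T \<in> \<T> \<Longrightarrow> corners T \<subseteq> vertices \<T>"
  by (auto simp: vertices_eq)

lemma mesh_face: "\<lbrakk>T \<in> \<T>; T' \<in> \<T>\<rbrakk> \<Longrightarrow> (T \<inter> T') face_of T"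
  using triangulation by (simp add: triangulation_of_def triangulation_def)

text \<open>A common face is spanned by its extreme points, and these are corners of both triangles.
  Hence affine functions on two triangles that agree at the common corners agree on the whole
  intersection, which is what makes nodal interpolation well defined.\<close>
lemma intersection_subset:
  assumes "T \<in> \<T>" "T' \<in> \<T>"
  shows "T \<inter> T' \<subseteq> convex hull (corners T \<inter> corners T')"
proof -
  have "compact (T \<inter> T')" "convex (T \<inter> T')"
    using assms by (auto intro: compact_Int compact_triangle convex_Int convex_triangle)
  then have "T \<inter> T' = convex hull {x. x extreme_point_of (T \<inter> T')}"
    by (rule Krein_Milman_Minkowski)
  moreover have "{x. x extreme_point_of (T \<inter> T')} \<subseteq> corners T \<inter> corners T'"
    using extreme_point_of_face[OF mesh_face[OF assms]]
      extreme_point_of_face[OF mesh_face[OF assms(2,1)]]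
    by (auto simp: corners_def Int_commute)
  ultimately show ?thesis using hull_mono by metis
qed

lemma diameter_le: "T \<in> \<T> \<Longrightarrow> diameter T \<le> h"
  using finite_mesh by (simp add: mesh_size_def)

lemma dist_triangle_le: "\<lbrakk>T \<in> \<T>; x \<in> T; y \<in> T\<rbrakk> \<Longrightarrow> norm (x - y) \<le> h"
  using diameter_le[of T] diameter_bounded_bound[of T x y] compact_imp_bounded[OF compact_triangle, of T]
  by (simp add: dist_norm)

lemma mesh_size_pos: "0 < h"
proof -
  obtain x where "x \<in> \<Omega>" using domain_nonempty by blast
  then obtain T where T: "T \<in> \<T>" using mesh_cover[of x] closure_subset by blast
  have "card (corners T) \<noteq> 0" "\<not> card (corners T) \<le> 1" using triangle_simplex(3)[OF T] by auto
  then obtain p q where "p \<in> corners T" "q \<in> corners T" "p \<noteq> q"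
    by (metis One_nat_def card_le_Suc0_iff_eq triangle_simplex(1)[OF T])
  then have "0 < norm (p - q)" "norm (p - q) \<le> h"
    using dist_triangle_le[OF T] corners_subset[OF T] by auto
  then show ?thesis by linarith
qed

lemma radius_pos: "0 < \<rho> * h"
  using rho_pos mesh_size_pos by simp

lemma interior_nonempty: "T \<in> \<T> \<Longrightarrow> interior T \<noteq> {}"
proof -
  assume "T \<in> \<T>"
  then obtain x where "ball x (\<rho> * h) \<subseteq> T" using balls by blast
  then have "x \<in> interior T" using radius_pos centre_in_ball interior_maximal open_ball by blast
  then show ?thesis by blast
qed

lemma closure_interior: "T \<in> \<T> \<Longrightarrow> closure (interior T) = T"
  using convex_closure_interior[OF convex_triangle interior_nonempty] compact_triangle
  by (simp add: compact_imp_closed)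

lemma interior_subset_domain: "T \<in> \<T> \<Longrightarrow> interior T \<subseteq> \<Omega>"
  using interior_mono[OF triangle_subset] interior_closure_domain by simp

text \<open>The intersection is a face of both triangles. It is a proper face of at least one of them and
  so avoids the interior of that one.\<close>
lemma interiors_disjoint:
  assumes "T \<in> \<T>" "T' \<in> \<T>" "T \<noteq> T'"
  shows "interior T \<inter> interior T' = {}"
proof (cases "T \<inter> T' = T")
  case True
  then have "T \<inter> T' \<noteq> T'" using assms by blast
  then have "(T \<inter> T') \<inter> interior T' = {}"
    using face_of_disjoint_interior[of "T \<inter> T'" T'] mesh_face[OF assms(2,1)]
    by (simp add: Int_commute)
  then show ?thesis using True interior_subset by blast
next
  case False
  then have "(T \<inter> T') \<inter> interior T = {}"
    using face_of_disjoint_interior mesh_face[OF assms(1,2)] by blast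
  then show ?thesis using interior_subset by blast
qed

lemma negligible_skeleton: "negligible (\<Omega> - (\<Union>T\<in>\<T>. interior T))"
proof (rule negligible_subset)
  show "negligible (\<Union>T\<in>\<T>. frontier T)"
    using finite_mesh convex_triangle negligible_convex_frontier by (intro negligible_Union) auto
  show "\<Omega> - (\<Union>T\<in>\<T>. interior T) \<subseteq> (\<Union>T\<in>\<T>. frontier T)"
  proof
    fix x assume x: "x \<in> \<Omega> - (\<Union>T\<in>\<T>. interior T)"
    then obtain T where "T \<in> \<T>" "x \<in> T" using mesh_cover[of x] closure_subset[of \<Omega>] by blast
    with x show "x \<in> (\<Union>T\<in>\<T>. frontier T)"
      using closure_subset[of T] by (auto simp: frontier_def)
  qed
qed

lemma AE_interior: "AE x \<in> \<Omega> in lebesgue. \<exists>T\<in>\<T>. x \<in> interior T"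
  using negligible_skeleton
  by (intro AE_I'[of "\<Omega> - (\<Union>T\<in>\<T>. interior T)"]) (auto simp: negligible_iff_null_sets)

lemma continuous_pieces:
  assumes "\<And>T. T \<in> \<T> \<Longrightarrow> continuous_on T f"
  shows "continuous_on (closure \<Omega>) f"
  using continuous_on_closed_Union[of \<T> "\<lambda>T. T" f] assms finite_mesh compact_triangle
  by (simp add: compact_imp_closed Union_mesh)

text \<open>On each triangle the affine interpolant of the corner values is taken. At a point shared by
  several triangles \<open>intersection_subset\<close> makes the choice of triangle irrelevant.\<close>
lemma V1_interpolant: "\<exists>f\<in>V1 \<Omega> \<T>. \<forall>p\<in>vertices \<T>. f p = val p"
proof -
  have "\<forall>T\<in>\<T>. \<exists>ab. \<forall>p\<in>corners T. fst ab + snd ab \<bullet> p = val p"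
    using affine_interpolant[OF triangle_simplex(2)] by simp
  then obtain ab where ab: "\<And>T p. \<lbrakk>T \<in> \<T>; p \<in> corners T\<rbrakk> \<Longrightarrow> fst (ab T) + snd (ab T) \<bullet> p = val p"
    by metis
  define t where "t x = (SOME T. T \<in> \<T> \<and> x \<in> T)" for x
  define f where "f x = (if x \<in> closure \<Omega> then fst (ab (t x)) + snd (ab (t x)) \<bullet> x else 0)" for x
  have f: "f x = fst (ab T) + snd (ab T) \<bullet> x" if T: "T \<in> \<T>" "x \<in> T" for x T
  proof -
    have t: "t x \<in> \<T>" "x \<in> t x" unfolding t_def using someI[of "\<lambda>T. T \<in> \<T> \<and> x \<in> T" T] T by auto
    have "fst (ab (t x)) + snd (ab (t x)) \<bullet> x = fst (ab T) + snd (ab T) \<bullet> x"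
    proof (rule affine_eq_on_convex_hull)
      show "x \<in> convex hull (corners (t x) \<inter> corners T)"
        using intersection_subset[OF t(1) T(1)] t T by blast
    qed (use ab t T in auto)
    then show ?thesis using triangle_subset T by (auto simp: f_def)
  qed
  have "continuous_on (closure \<Omega>) f"
  proof (rule continuous_pieces)
    fix T assume T: "T \<in> \<T>"
    have "continuous_on T (\<lambda>x. fst (ab T) + snd (ab T) \<bullet> x)" by (intro continuous_intros)
    then show "continuous_on T f" using f[OF T] by (simp cong: continuous_on_cong)
  qed
  then have "f \<in> V1 \<Omega> \<T>" using f by (auto simp: V1_def f_def)
  moreover have "f p = val p" if "p \<in> vertices \<T>" for p
    using that f ab corners_subset by (fastforce simp: vertices_eq)
  ultimately show ?thesis by blast
qed

lemma V1_affine: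
  assumes "f \<in> V1 \<Omega> \<T>" "T \<in> \<T>"
  obtains a b where "\<And>x. x \<in> T \<Longrightarrow> f x = a + b \<bullet> x"
  using assms by (auto simp: V1_def)

lemma V1_eqI:
  assumes f: "f \<in> V1 \<Omega> \<T>" and g: "g \<in> V1 \<Omega> \<T>" and eq: "\<And>p. p \<in> vertices \<T> \<Longrightarrow> f p = g p"
  shows "f = g"
proof
  fix x
  show "f x = g x"
  proof (cases "x \<in> closure \<Omega>")
    case True
    then obtain T where T: "T \<in> \<T>" "x \<in> T" using mesh_cover by blast
    obtain a b where ab: "\<And>x. x \<in> T \<Longrightarrow> f x = a + b \<bullet> x" using V1_affine[OF f T(1)] by metis
    obtain a' b' where ab': "\<And>x. x \<in> T \<Longrightarrow> g x = a' + b' \<bullet> x" using V1_affine[OF g T(1)] by metis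
    have "a + b \<bullet> x = a' + b' \<bullet> x"
    proof (rule affine_eq_on_convex_hull)
      show "x \<in> convex hull (corners T)" using triangle_simplex(4) T by simp
      fix p assume "p \<in> corners T"
      then show "a + b \<bullet> p = a' + b' \<bullet> p"
        using ab[of p] ab'[of p] eq[of p] corners_subset[OF T(1)] corners_vertices[OF T(1)]
        by (metis subsetD)
    qed
    then show ?thesis using ab ab' T by simp
  qed (use f g in \<open>auto simp: V1_def\<close>)
qed

lemma subspace_V1: "subspace (V1 \<Omega> \<T>)"
proof (rule subspaceI)
  show "0 \<in> V1 \<Omega> \<T>" by (auto simp: V1_def zero_fun_def intro!: exI[of _ 0])
next
  fix f g assume f: "f \<in> V1 \<Omega> \<T>" and g: "g \<in> V1 \<Omega> \<T>"
  have "\<exists>a b. \<forall>x\<in>T. (f + g) x = a + b \<bullet> x" if T: "T \<in> \<T>" for T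
  proof -
    obtain a b where "\<And>x. x \<in> T \<Longrightarrow> f x = a + b \<bullet> x" using V1_affine[OF f T] by metis
    moreover obtain a' b' where "\<And>x. x \<in> T \<Longrightarrow> g x = a' + b' \<bullet> x" using V1_affine[OF g T] by metis
    ultimately show ?thesis
      by (intro exI[of _ "a + a'"] exI[of _ "b + b'"]) (simp add: inner_add_left)
  qed
  then show "f + g \<in> V1 \<Omega> \<T>" using f g by (auto simp: V1_def plus_fun_def intro: continuous_on_add)
next
  fix c f assume f: "f \<in> V1 \<Omega> \<T>"
  have "\<exists>a b. \<forall>x\<in>T. (c *\<^sub>R f) x = a + b \<bullet> x" if T: "T \<in> \<T>" for T
  proof -
    obtain a b where "\<And>x. x \<in> T \<Longrightarrow> f x = a + b \<bullet> x" using V1_affine[OF f T] by metis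
    then show ?thesis
      by (intro exI[of _ "c * a"] exI[of _ "c *\<^sub>R b"]) (simp add: algebra_simps)
  qed
  then show "c *\<^sub>R f \<in> V1 \<Omega> \<T>"
    using f by (auto simp: V1_def scaleR_fun_def intro: continuous_on_mult_left)
qed

lemma nodal_basis:
  assumes "p \<in> vertices \<T>"
  shows "nodal_basis \<Omega> \<T> p \<in> V1 \<Omega> \<T>"
    and "q \<in> vertices \<T> \<Longrightarrow> nodal_basis \<Omega> \<T> p q = (if q = p then 1 else 0)"
proof -
  have "\<exists>!f. f \<in> V1 \<Omega> \<T> \<and> (\<forall>q\<in>vertices \<T>. f q = (if q = p then 1 else 0))"
    using V1_interpolant[of "\<lambda>q. if q = p then 1 else 0"] by (metis (mono_tags, lifting) V1_eqI)
  from theI'[OF this] show "nodal_basis \<Omega> \<T> p \<in> V1 \<Omega> \<T>"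
    "q \<in> vertices \<T> \<Longrightarrow> nodal_basis \<Omega> \<T> p q = (if q = p then 1 else 0)"
    unfolding nodal_basis_def by blast+
qed

definition interp :: "(real^2 \<Rightarrow> real) \<Rightarrow> real^2 \<Rightarrow> real" where
  "interp val = (\<Sum>p\<in>vertices \<T>. val p *\<^sub>R nodal_basis \<Omega> \<T> p)"

lemma sum_fun_apply: "(\<Sum>i\<in>I. F i) x = (\<Sum>i\<in>I. F i x :: 'b::ab_group_add)"
  by (induction I rule: infinite_finite_induct) auto

lemma interp_apply: "interp val x = (\<Sum>p\<in>vertices \<T>. val p * nodal_basis \<Omega> \<T> p x)"
  by (simp add: interp_def sum_fun_apply)

lemma interp_in_V1: "interp val \<in> V1 \<Omega> \<T>"
  unfolding interp_def
  by (intro subspace_sum subspace_scale subspace_V1 nodal_basis)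

lemma interp_vertex: "q \<in> vertices \<T> \<Longrightarrow> interp val q = val q"
  by (simp add: interp_apply nodal_basis finite_vertices if_distrib cong: if_cong)

lemma interp_V1: "f \<in> V1 \<Omega> \<T> \<Longrightarrow> interp f = f"
  by (intro V1_eqI interp_in_V1) (auto simp: interp_vertex)

lemma interp_add: "interp (\<lambda>p. f p + g p) = interp f + interp g"
  by (simp add: interp_def scaleR_left_distrib sum.distrib)

lemma interp_scale: "interp (\<lambda>p. c * f p) = c *\<^sub>R interp f"
  by (simp add: interp_def scaleR_sum_right)

lemma nodal_coeff:
  assumes "f \<in> V1 \<Omega> \<T>" "p \<in> vertices \<T>"
  shows "nodal_coeff \<Omega> \<T> f p = f p"
proof -
  have eq: "interp \<alpha> = (\<lambda>x. \<Sum>p\<in>vertices \<T>. \<alpha> p * nodal_basis \<Omega> \<T> p x)" for \<alpha>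
    by (simp add: interp_apply fun_eq_iff)
  have "nodal_coeff \<Omega> \<T> f = (\<lambda>p. if p \<in> vertices \<T> then f p else 0)" (is "_ = ?\<alpha>")
    unfolding nodal_coeff_def eq[symmetric]
  proof (rule the_equality, intro conjI allI impI)
    have "interp ?\<alpha> = interp f" by (simp add: interp_def)
    then show "f = interp ?\<alpha>" using interp_V1[OF assms(1)] by simp
  next
    fix \<alpha> assume "(\<forall>p. p \<notin> vertices \<T> \<longrightarrow> \<alpha> p = 0) \<and> f = interp \<alpha>"
    then show "\<alpha> = ?\<alpha>" using interp_vertex[of _ \<alpha>] by auto
  qed auto
  then show ?thesis using assms by simp
qed

end

section \<open>Gradients of quadratic polynomials on one triangle\<close>

lemma norm_matrix_vector_le:
  fixes A :: "real^2^2"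
  shows "norm (A *v x) \<le> norm A * norm x"
proof (rule power2_le_imp_le)
  have "(A *v x) $ i = A $ i \<bullet> x" for i
    by (simp add: matrix_vector_mult_def inner_vec_def)
  then have "(norm (A *v x))\<^sup>2 = (\<Sum>i\<in>UNIV. (A $ i \<bullet> x)\<^sup>2)"
    unfolding power2_norm_eq_inner inner_vec_def[of "A *v x" "A *v x"] by (simp add: power2_eq_square)
  also have "\<dots> \<le> (\<Sum>i\<in>UNIV. (A $ i \<bullet> A $ i) * (x \<bullet> x))"
    by (intro sum_mono Cauchy_Schwarz_ineq)
  also have "\<dots> = (norm A * norm x)\<^sup>2"
    unfolding power_mult_distrib power2_norm_eq_inner inner_vec_def[of A A]
    by (simp add: sum_distrib_right)
  finally show "(norm (A *v x))\<^sup>2 \<le> (norm A * norm x)\<^sup>2" .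
qed simp

lemma norm_matrix_columns:
  fixes A :: "real^2^2"
  shows "(norm A)\<^sup>2 = (norm (A *v axis 1 1))\<^sup>2 + (norm (A *v axis 2 1))\<^sup>2"
  unfolding power2_norm_eq_inner matrix_vector_mult_basis
  by (simp add: inner_vec_def sum_2 column_def)

definition symm :: "real^2^2 \<Rightarrow> real^2^2" where
  "symm M = (1/2) *\<^sub>R (M + transpose M)"

text \<open>A quadratic form sees only the symmetric part of its matrix; for the gradient of a
  displacement this part is the strain.\<close>
lemma symm_quadratic: "x \<bullet> (M *v x) = x \<bullet> (symm M *v x)"
  by (simp add: symm_def matrix_vector_mult_def inner_vec_def sum_2 transpose_def field_simps)

lemma symm_swap: "x \<bullet> (symm M *v y) = y \<bullet> (symm M *v x)"
  by (simp add: symm_def matrix_vector_mult_def inner_vec_def sum_2 transpose_def field_simps)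

text \<open>For a quadratic polynomial \<open>Q\<close> that vanishes at all corners, the difference of \<open>Q\<close> between the
  ends of an edge \<open>e\<close> at \<open>p0\<close> shows that the derivative of \<open>Q\<close> at \<open>p0\<close> along \<open>e\<close> is minus the
  quadratic form at \<open>e\<close>, hence of size \<open>d\<^sup>2\<close>. So the gradient \<open>v\<close> at \<open>p0\<close> nearly annihilates the
  triangle: \<open>v \<bullet> (z - p0)\<close> is small for all \<open>z\<close> in it. As the triangle contains a disc, it is wide
  in the direction of \<open>v\<close>, and \<open>v\<close> must be small. The gradient elsewhere differs from \<open>v\<close> by the
  bounded term \<open>2 \<epsilon> (x - p0)\<close>.\<close>
lemma quadratic_gradient_upper:
  assumes hull: "x \<in> convex hull C" and p0: "p0 \<in> C"
    and diam: "\<And>x y. \<lbrakk>x \<in> convex hull C; y \<in> convex hull C\<rbrakk> \<Longrightarrow> norm (x - y) \<le> d"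
    and ball: "ball c r \<subseteq> convex hull C" and "0 < r"
    and zero: "\<And>p. p \<in> C \<Longrightarrow> \<alpha> + g \<bullet> p + p \<bullet> (M *v p) = 0"
  shows "norm (g + 2 *\<^sub>R (symm M *v x)) \<le> (4 * d\<^sup>2 / r + 2 * d) * norm (symm M)"
proof -
  define E where "E = symm M"
  define v where "v = g + 2 *\<^sub>R (E *v p0)"
  have p0': "p0 \<in> convex hull C" using p0 by (simp add: hull_inc)
  have d: "0 \<le> d" using diam[OF p0' p0'] by simp
  have edge: "\<bar>v \<bullet> (p - p0)\<bar> \<le> d\<^sup>2 * norm E" if p: "p \<in> C" for p
  proof -
    define e where "e = p - p0"
    have ne: "norm e \<le> d" using diam[of p p0] p p0' by (simp add: e_def hull_inc)
    have "g \<bullet> p + p \<bullet> (E *v p) = g \<bullet> p0 + p0 \<bullet> (E *v p0)"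
      using zero[OF p] zero[OF p0] by (simp add: symm_quadratic[of _ M] E_def)
    moreover have "p = p0 + e" by (simp add: e_def)
    ultimately have "g \<bullet> e + 2 * (e \<bullet> (E *v p0)) + e \<bullet> (E *v e) = 0"
      using symm_swap[of p0 M e]
      by (simp add: E_def inner_add_left inner_add_right matrix_vector_right_distrib)
    then have "v \<bullet> e = - (e \<bullet> (E *v e))"
      by (simp add: v_def inner_add_right inner_commute[of _ e])
    then have "\<bar>v \<bullet> e\<bar> \<le> norm e * norm (E *v e)" by (simp add: Cauchy_Schwarz_ineq2)
    also have "\<dots> \<le> norm e * (norm E * norm e)"
      by (intro mult_left_mono norm_matrix_vector_le) simp
    also have "\<dots> = norm E * (norm e)\<^sup>2" by (simp add: power2_eq_square)
    also have "\<dots> \<le> norm E * d\<^sup>2" using ne by (intro mult_left_mono power_mono) auto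
    finally show ?thesis by (simp add: e_def mult.commute)
  qed
  have slab: "\<bar>v \<bullet> (z - p0)\<bar> \<le> d\<^sup>2 * norm E" if "z \<in> convex hull C" for z
  proof -
    let ?K = "d\<^sup>2 * norm E"
    have "convex hull C \<subseteq> {z. v \<bullet> z \<le> v \<bullet> p0 + ?K} \<inter> {z. v \<bullet> z \<ge> v \<bullet> p0 - ?K}"
      using edge
      by (intro hull_minimal convex_Int convex_halfspace_le convex_halfspace_ge)
         (force simp: inner_diff_right abs_le_iff)
    then show ?thesis using that by (force simp: inner_diff_right abs_le_iff)
  qed
  have nv: "norm v \<le> 4 * d\<^sup>2 / r * norm E"
  proof (cases "v = 0")
    case True
    then show ?thesis using \<open>0 < r\<close> by simp
  next
    case False
    \<comment> \<open>half a radius away from the centre in the direction of \<open>v\<close>, so that \<open>v \<bullet> (z - c) = r \<bar>v\<bar> / 2\<close>\<close>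
    define z where "z = c + (r / (2 * norm v)) *\<^sub>R v"
    have "dist c z = r / 2" using False \<open>0 < r\<close> by (simp add: z_def dist_norm)
    then have "c \<in> ball c r" "z \<in> ball c r" using \<open>0 < r\<close> by auto
    then have "\<bar>v \<bullet> (c - p0)\<bar> \<le> d\<^sup>2 * norm E" "\<bar>v \<bullet> (z - p0)\<bar> \<le> d\<^sup>2 * norm E"
      using slab ball by blast+
    then have "v \<bullet> (z - c) \<le> 2 * (d\<^sup>2 * norm E)" by (simp add: inner_diff_right abs_le_iff)
    moreover have "v \<bullet> (z - c) = r / 2 * norm v"
      using False by (simp add: z_def dot_square_norm power2_eq_square)
    ultimately show ?thesis using \<open>0 < r\<close> by (simp add: field_simps)
  qed
  have "g + 2 *\<^sub>R (E *v x) = v + 2 *\<^sub>R (E *v (x - p0))"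
    by (simp add: v_def matrix_vector_mult_diff_distrib scaleR_diff_right)
  then have "norm (g + 2 *\<^sub>R (E *v x)) \<le> norm v + 2 * norm (E *v (x - p0))"
    by (metis norm_triangle_ineq norm_scaleR abs_numeral)
  also have "norm (E *v (x - p0)) \<le> norm E * d"
    using norm_matrix_vector_le[of E "x - p0"] diam[OF hull p0']
    by (meson mult_left_mono norm_ge_zero order_trans)
  finally show ?thesis using nv by (simp add: E_def algebra_simps)
qed

text \<open>Some column of \<open>A\<close> carries at least half of the squared norm. Moving from the centre by \<open>r/2\<close> in
  that coordinate direction changes the field by at least \<open>0.35 r \<bar>A\<bar>\<close>, so at one of the two end
  points it has length \<open>0.175 r \<bar>A\<bar>\<close>; within a distance of \<open>r/8\<close> at most \<open>0.125 r \<bar>A\<bar>\<close> of this is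
  lost, and \<open>r/20 \<bar>A\<bar>\<close> remains. A bound on a disc of comparable size gives a bound of the integral
  by a mere volume comparison.\<close>
lemma affine_field_lower:
  fixes A :: "real^2^2"
  assumes "0 < r"
  obtains y where "ball y (r / 8) \<subseteq> ball c r"
    and "\<And>x. x \<in> ball y (r / 8) \<Longrightarrow> r / 20 * norm A \<le> norm (g + A *v x)"
proof -
  define G where "G x = g + A *v x" for x
  have diff: "G x - G y = A *v (x - y)" for x y
    by (simp add: G_def matrix_vector_mult_diff_distrib)
  have "(norm A)\<^sup>2 / 2 \<le> (norm (A *v axis 1 1))\<^sup>2 \<or> (norm A)\<^sup>2 / 2 \<le> (norm (A *v axis 2 1))\<^sup>2"
    using norm_matrix_columns[of A] by linarith
  then obtain k where k: "(norm A)\<^sup>2 / 2 \<le> (norm (A *v axis k 1))\<^sup>2" by blast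
  have "0.7 * norm A \<le> norm (A *v axis k 1)"
  proof (rule power2_le_imp_le)
    have "(0.7 * norm A)\<^sup>2 = 0.49 * (norm A)\<^sup>2" by (simp add: power2_eq_square)
    also have "\<dots> \<le> (norm A)\<^sup>2 / 2" by simp
    also note k
    finally show "(0.7 * norm A)\<^sup>2 \<le> (norm (A *v axis k 1))\<^sup>2" .
  qed simp
  then have col: "r / 2 * (0.7 * norm A) \<le> r / 2 * norm (A *v axis k 1)"
    using assms by (intro mult_left_mono) auto
  define z where "z = c + (r / 2) *\<^sub>R axis k 1"
  have "norm (G z - G c) = r / 2 * norm (A *v axis k 1)"
    using assms by (simp add: diff z_def matrix_vector_mult_scaleR)
  then have "r / 2 * (0.7 * norm A) \<le> norm (G z) + norm (G c)"
    using col norm_triangle_ineq4[of "G z" "G c"] by linarith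
  then have "r / 4 * (0.7 * norm A) \<le> norm (G c) \<or> r / 4 * (0.7 * norm A) \<le> norm (G z)"
    by linarith
  then obtain y where y: "y = c \<or> y = z" "r / 4 * (0.7 * norm A) \<le> norm (G y)" by blast
  show ?thesis
  proof (rule that[of y])
    have "dist c y \<le> r / 2" using y(1) assms by (auto simp: z_def dist_norm norm_axis_1)
    then show "ball y (r / 8) \<subseteq> ball c r"
      using assms dist_triangle[of c _ y] by (fastforce intro: le_less_trans)
    fix x assume "x \<in> ball y (r / 8)"
    then have "norm (y - x) \<le> r / 8" by (simp add: dist_norm)
    then have "norm (G y - G x) \<le> norm A * (r / 8)"
      unfolding diff using norm_matrix_vector_le by (meson mult_left_mono norm_ge_zero order_trans)
    moreover have "norm (G y) \<le> norm (G x) + norm (G y - G x)"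
      by (metis add.commute diff_add_cancel norm_triangle_ineq)
    moreover have "r / 4 * (0.7 * norm A) = r / 20 * norm A + norm A * (r / 8)"
      by simp
    ultimately show "r / 20 * norm A \<le> norm (g + A *v x)"
      using y(2) unfolding G_def by linarith
  qed
qed

section \<open>Integrals of piecewise continuous functions\<close>

lemma has_derivative_quadratic:
  fixes f :: "real^2 \<Rightarrow> real"
  assumes "open S" "x \<in> S" and f: "\<And>y. y \<in> S \<Longrightarrow> f y = a + b \<bullet> y + y \<bullet> (A *v y)"
  shows "(f has_derivative (\<lambda>d. (b + 2 *\<^sub>R (symm A *v x)) \<bullet> d)) (at x)"
proof -
  have "((\<lambda>y. a + b \<bullet> y + y \<bullet> (symm A *v y)) has_derivative
      (\<lambda>d. b \<bullet> d + (x \<bullet> (symm A *v d) + d \<bullet> (symm A *v x)))) (at x)"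
    by (auto intro!: derivative_eq_intros bounded_linear_imp_has_derivative matrix_vector_mul_bounded_linear)
  moreover have "b \<bullet> d + (x \<bullet> (symm A *v d) + d \<bullet> (symm A *v x)) = (b + 2 *\<^sub>R (symm A *v x)) \<bullet> d" for d
    using symm_swap[of x A d] by (simp add: inner_add_right inner_commute[of _ d])
  ultimately have "((\<lambda>y. a + b \<bullet> y + y \<bullet> (symm A *v y)) has_derivative
      (\<lambda>d. (b + 2 *\<^sub>R (symm A *v x)) \<bullet> d)) (at x)" by simp
  then show ?thesis
    using assms(1,2) by (rule has_derivative_transform_within_open) (simp add: f symm_quadratic[of _ A])
qed

lemma grad_eqI:
  assumes "(f has_derivative (\<lambda>d. g \<bullet> d)) (at x)"
  shows "grad f x = g" "partial_deriv k f x = g $ k"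
proof -
  show "partial_deriv k f x = g $ k" for k
    unfolding partial_deriv_def frechet_derivative_at[OF assms, symmetric]
    by (simp add: inner_axis)
  then show "grad f x = g" by (simp add: grad_def vec_eq_iff)
qed

lemma has_derivative_grad:
  assumes "f differentiable (at x)"
  shows "(f has_derivative (\<lambda>d. grad f x \<bullet> d)) (at x)"
proof -
  have D: "(f has_derivative frechet_derivative f (at x)) (at x)"
    using assms frechet_derivative_works by blast
  then have lin: "linear (frechet_derivative f (at x))" by (rule has_derivative_linear)
  have "frechet_derivative f (at x) d = grad f x \<bullet> d" for d
  proof -
    have "d = (\<Sum>k\<in>UNIV. d $ k *\<^sub>R axis k 1)"
      by (simp add: vec_eq_iff axis_def sum_2 forall_2)
    then have "frechet_derivative f (at x) d = (\<Sum>k\<in>UNIV. d $ k *\<^sub>R frechet_derivative f (at x) (axis k 1))"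
      using linear_sum[OF lin] linear_cmul[OF lin] by (metis (no_types, lifting) sum.cong)
    then show ?thesis by (simp add: grad_def partial_deriv_def inner_vec_def mult.commute)
  qed
  then show ?thesis using D by (metis (no_types, lifting) ext)
qed

lemma grad_add:
  assumes "f differentiable (at x)" "g differentiable (at x)"
  shows "grad (f + g) x = grad f x + grad g x"
proof (rule grad_eqI)
  show "((f + g) has_derivative (\<lambda>d. (grad f x + grad g x) \<bullet> d)) (at x)"
    unfolding plus_fun_def inner_add_left
    by (intro has_derivative_add has_derivative_grad assms)
qed

lemma grad_scale:
  assumes "f differentiable (at x)"
  shows "grad (c *\<^sub>R f) x = c *\<^sub>R grad f x"
proof (rule grad_eqI)
  show "((c *\<^sub>R f) has_derivative (\<lambda>d. (c *\<^sub>R grad f x) \<bullet> d)) (at x)"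
    unfolding scaleR_fun_def inner_scaleR_left real_scaleR_def
    by (intro has_derivative_mult_right has_derivative_grad assms)
qed

context shape_regular_mesh
begin

text \<open>A mesh function is described by a continuous function of the whole plane for each triangle, so
  its values on the edges, where derivatives are arbitrary, are left open. Integrals over the domain
  ignore the edges, and a continuous representative is integrable on the bounded triangle.\<close>
definition piecewise :: "(real^2 \<Rightarrow> 'b::euclidean_space) \<Rightarrow> bool" where
  "piecewise f \<longleftrightarrow> (\<forall>T\<in>\<T>. \<exists>g. continuous_on UNIV g \<and> (\<forall>x\<in>interior T. f x = g x))"

lemma piecewise_compose2:
  assumes "piecewise f" "piecewise g" and H: "continuous_on UNIV (\<lambda>z. H (fst z) (snd z))"
  shows "piecewise (\<lambda>x. H (f x) (g x))"
  unfolding piecewise_def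
proof
  fix T assume "T \<in> \<T>"
  with assms(1,2) obtain f' g' where "continuous_on UNIV f'" "\<forall>x\<in>interior T. f x = f' x"
    "continuous_on UNIV g'" "\<forall>x\<in>interior T. g x = g' x" unfolding piecewise_def by metis
  moreover from this have "continuous_on UNIV (\<lambda>x. (f' x, g' x))"
    by (intro continuous_on_Pair)
  then have "continuous_on UNIV (\<lambda>x. H (f' x) (g' x))"
    using continuous_on_compose2[OF H, of UNIV "\<lambda>x. (f' x, g' x)"] by simp
  ultimately show "\<exists>k. continuous_on UNIV k \<and> (\<forall>x\<in>interior T. H (f x) (g x) = k x)"
    by (intro exI[of _ "\<lambda>x. H (f' x) (g' x)"]) auto
qed

lemma piecewise_add: "piecewise f \<Longrightarrow> piecewise g \<Longrightarrow> piecewise (\<lambda>x. f x + g x)"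
  and piecewise_inner: "piecewise f \<Longrightarrow> piecewise g \<Longrightarrow> piecewise (\<lambda>x. f x \<bullet> g x)"
  by (auto intro!: piecewise_compose2[where f = f and g = g] continuous_intros)

lemma piecewise_mult:
  fixes f g :: "real^2 \<Rightarrow> real"
  shows "piecewise f \<Longrightarrow> piecewise g \<Longrightarrow> piecewise (\<lambda>x. f x * g x)"
  using piecewise_inner[of f g] by simp

text \<open>The restriction to a closed triangle extends continuously to the plane by Tietze's theorem.\<close>
lemma piecewise_continuous:
  fixes f :: "real^2 \<Rightarrow> 'b::euclidean_space"
  assumes "continuous_on (closure \<Omega>) f"
  shows "piecewise f"
  unfolding piecewise_def
proof
  fix T assume T: "T \<in> \<T>"
  have "continuous_on T f" using assms triangle_subset[OF T] continuous_on_subset by blast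
  then obtain g where "continuous_on UNIV g" "\<And>x. x \<in> T \<Longrightarrow> g x = f x"
    using Tietze_unbounded[of T f UNIV] compact_triangle[OF T] compact_imp_closed
    by (metis closedin_closed_subset closed_closedin closedin_subtopology_refl subtopology_UNIV topspace_euclidean subset_UNIV)
  then show "\<exists>g. continuous_on UNIV g \<and> (\<forall>x\<in>interior T. f x = g x)"
    using interior_subset by (metis subsetD)
qed

lemma piecewise_const: "piecewise (\<lambda>x. c)"
  by (rule piecewise_continuous) simp

lemma integrable_triangle:
  assumes "piecewise f" "T \<in> \<T>"
  shows "set_integrable lebesgue (interior T) f"
proof -
  obtain g where g: "continuous_on UNIV g" "\<forall>x\<in>interior T. f x = g x"
    using assms unfolding piecewise_def by blast
  obtain a where a: "T \<subseteq> cbox (- a) a"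
    using bounded_subset_cbox_symmetric compact_imp_bounded[OF compact_triangle[OF assms(2)]] by blast
  have "set_integrable lebesgue (cbox (- a) a) g"
    by (rule absolutely_integrable_continuous) (use g continuous_on_subset in blast)
  then have "set_integrable lebesgue (interior T) g"
    using a interior_subset by (rule_tac set_integrable_subset) (auto intro: lmeasurable_open)
  moreover have "(\<lambda>x. indicator (interior T) x *\<^sub>R g x) = (\<lambda>x. indicator (interior T) x *\<^sub>R f x)"
    using g(2) by (auto simp: indicator_def fun_eq_iff)
  ultimately show ?thesis by (simp add: set_integrable_def)
qed

lemma integrable_interiors: "piecewise f \<Longrightarrow> set_integrable lebesgue (\<Union>T\<in>\<T>. interior T) f"
  by (intro set_integrable_UN finite_mesh integrable_triangle) auto

lemma integrable_piecewise:
  assumes "piecewise f"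
  shows "set_integrable lebesgue \<Omega> f"
proof -
  have "negligible {x \<in> \<Omega> - (\<Union>T\<in>\<T>. interior T). f x \<noteq> 0}"
    by (rule negligible_subset[OF negligible_skeleton]) auto
  moreover have "{x \<in> (\<Union>T\<in>\<T>. interior T) - \<Omega>. f x \<noteq> 0} = {}"
    using interior_subset_domain by blast
  then have "negligible {x \<in> (\<Union>T\<in>\<T>. interior T) - \<Omega>. f x \<noteq> 0}"
    by (metis negligible_empty)
  ultimately show ?thesis
    using integrable_interiors[OF assms] absolutely_integrable_spike_set_eq by blast
qed

lemma AE_eqI:
  assumes "\<And>T x. \<lbrakk>T \<in> \<T>; x \<in> interior T\<rbrakk> \<Longrightarrow> P x"
  shows "AE x\<in>\<Omega> in lebesgue. P x"
  using AE_interior by eventually_elim (use assms in blast)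

lemma integral_piecewise_cong:
  fixes f :: "real^2 \<Rightarrow> real"
  assumes "piecewise f" and eq: "\<And>T x. \<lbrakk>T \<in> \<T>; x \<in> interior T\<rbrakk> \<Longrightarrow> f x = g x"
  shows "(LINT x:\<Omega>|lebesgue. f x) = (LINT x:\<Omega>|lebesgue. g x)"
proof -
  have "piecewise g" using assms unfolding piecewise_def by metis
  then have "set_integrable lebesgue \<Omega> f" "set_integrable lebesgue \<Omega> g"
    using integrable_piecewise assms(1) by blast+
  then show ?thesis
    unfolding set_lebesgue_integral_def set_integrable_def
    using AE_eqI[of "\<lambda>x. f x = g x"] eq by (intro integral_cong_AE) auto
qed

lemma integral_piecewise_add:
  fixes f g :: "real^2 \<Rightarrow> real"
  assumes "piecewise f" "piecewise g"
    and eq: "\<And>T x. \<lbrakk>T \<in> \<T>; x \<in> interior T\<rbrakk> \<Longrightarrow> k x = f x + g x"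
  shows "(LINT x:\<Omega>|lebesgue. k x) = (LINT x:\<Omega>|lebesgue. f x) + (LINT x:\<Omega>|lebesgue. g x)"
  using integral_piecewise_cong[OF piecewise_add[OF assms(1,2)], of k] eq
    set_integral_add(2)[OF integrable_piecewise[OF assms(1)] integrable_piecewise[OF assms(2)]] by simp

lemma integral_piecewise_scale:
  fixes f :: "real^2 \<Rightarrow> real"
  assumes "piecewise f" and eq: "\<And>T x. \<lbrakk>T \<in> \<T>; x \<in> interior T\<rbrakk> \<Longrightarrow> k x = c * f x"
  shows "(LINT x:\<Omega>|lebesgue. k x) = c * (LINT x:\<Omega>|lebesgue. f x)"
  using integral_piecewise_cong[OF piecewise_mult[OF piecewise_const[of c] assms(1)], of k] eq by simp

lemma integral_piecewise_mono:
  fixes f g :: "real^2 \<Rightarrow> real"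
  assumes "piecewise f" "piecewise g"
    and "\<And>T x. \<lbrakk>T \<in> \<T>; x \<in> interior T\<rbrakk> \<Longrightarrow> f x \<le> g x"
  shows "(LINT x:\<Omega>|lebesgue. f x) \<le> (LINT x:\<Omega>|lebesgue. g x)"
  using assms by (intro set_integral_mono_AE integrable_piecewise AE_eqI)

lemma integral_sum_triangles:
  fixes f :: "real^2 \<Rightarrow> real"
  assumes "piecewise f"
  shows "(LINT x:\<Omega>|lebesgue. f x) = (\<Sum>T\<in>\<T>. LINT x:interior T|lebesgue. f x)"
proof -
  have "(LINT x:\<Omega>|lebesgue. f x) = (LINT x:(\<Union>T\<in>\<T>. interior T)|lebesgue. f x)"
    unfolding set_lebesgue_integral_def
  proof (rule integral_cong_AE)
    show "AE x in lebesgue. indicator \<Omega> x *\<^sub>R f x = indicator (\<Union>T\<in>\<T>. interior T) x *\<^sub>R f x"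
      using AE_interior
      by eventually_elim (use interior_subset_domain in \<open>auto simp: indicator_def\<close>)
  qed (use integrable_piecewise[OF assms] integrable_interiors[OF assms] in \<open>auto simp: set_integrable_def\<close>)
  also have "\<dots> = (\<Sum>T\<in>\<T>. LINT x:interior T|lebesgue. f x)"
    using assms interiors_disjoint
    by (intro set_integral_finite_Union finite_mesh integrable_triangle)
       (auto simp: disjoint_family_on_def)
  finally show ?thesis .
qed

text \<open>If \<open>f\<close> were positive at an interior point, it would be positive on a nonempty open set, which
  is not a null set.\<close>
lemma piecewise_integral_zero:
  fixes f :: "real^2 \<Rightarrow> real"
  assumes "piecewise f" "\<And>x. 0 \<le> f x" "(LINT x:\<Omega>|lebesgue. f x) = 0"
    and T: "T \<in> \<T>" "x \<in> interior T"
  shows "f x = 0"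
proof (rule ccontr)
  assume "f x \<noteq> 0"
  obtain g where g: "continuous_on UNIV g" "\<forall>x\<in>interior T. f x = g x"
    using assms unfolding piecewise_def by blast
  have "AE y in lebesgue. indicator \<Omega> y *\<^sub>R f y = 0"
    using integral_nonneg_eq_0_iff_AE[of lebesgue "\<lambda>x. indicator \<Omega> x *\<^sub>R f x"] integrable_piecewise[OF assms(1)] assms(2,3)
    by (simp add: set_integrable_def set_lebesgue_integral_def)
  then obtain N where N: "N \<in> null_sets lebesgue" "{y. indicator \<Omega> y *\<^sub>R f y \<noteq> 0} \<subseteq> N"
    by (auto simp: eventually_ae_filter)
  define U where "U = interior T \<inter> g -` (- {0})"
  have "open (g -` (- {0}))" by (rule open_vimage[OF _ g(1)]) (simp add: open_Compl)
  then have "open U" by (simp add: U_def open_Int)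
  moreover have "x \<in> U" using \<open>f x \<noteq> 0\<close> T g(2) by (simp add: U_def)
  moreover have "U \<subseteq> {y. indicator \<Omega> y *\<^sub>R f y \<noteq> 0}"
    using g(2) interior_subset_domain[OF T(1)] by (auto simp: U_def)
  then have "negligible U" using N negligible_iff_null_sets negligible_subset by blast
  ultimately show False using open_not_negligible by blast
qed

end

section \<open>Finite element spaces and their bilinear forms\<close>

lemma frobenius_inner: "frobenius A B = A \<bullet> B"
  by (simp add: frobenius_def inner_vec_def)

lemma divergence_strain: "divergence u x = (\<Sum>k\<in>UNIV. strain u x $ k $ k)"
  by (simp add: divergence_def strain_def)

lemma symm_add: "symm (M + N) = symm M + symm N"
  by (simp add: symm_def vec_eq_iff transpose_def field_simps)

lemma symm_scale: "symm (c *\<^sub>R M) = c *\<^sub>R symm M"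
  by (simp add: symm_def vec_eq_iff transpose_def field_simps)

text \<open>This bounds the divergence by the strain; the constant 2 is the space dimension.\<close>
lemma trace_power2_le: "(\<Sum>k\<in>UNIV. A $ k $ k)\<^sup>2 \<le> 2 * (A \<bullet> A)" for A :: "real^2^2"
proof -
  have "(A $ 1 $ 1 + A $ 2 $ 2)\<^sup>2 \<le> 2 * ((A $ 1 $ 1)\<^sup>2 + (A $ 2 $ 2)\<^sup>2)"
    using zero_le_power2[of "A $ 1 $ 1 - A $ 2 $ 2"] by (simp add: power2_eq_square algebra_simps)
  moreover have "A \<bullet> A = (A $ 1 $ 1)\<^sup>2 + (A $ 1 $ 2)\<^sup>2 + ((A $ 2 $ 1)\<^sup>2 + (A $ 2 $ 2)\<^sup>2)"
    by (simp add: sum_2 inner_vec_def power2_eq_square)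
  ultimately have "(A $ 1 $ 1 + A $ 2 $ 2)\<^sup>2 \<le> 2 * (A \<bullet> A)"
    using zero_le_power2[of "A $ 1 $ 2"] zero_le_power2[of "A $ 2 $ 1"] by argo
  then show ?thesis by (simp only: sum_2)
qed

context shape_regular_mesh
begin

lemma P2_quadratic:
  assumes "f \<in> P2 \<Omega> \<T>" "T \<in> \<T>"
  obtains a b A where "\<And>x. x \<in> T \<Longrightarrow> f x = a + b \<bullet> x + x \<bullet> (A *v x)"
  using assms by (auto simp: P2_def)

lemma subspace_P2: "subspace (P2 \<Omega> \<T>)"
proof (rule subspaceI)
  show "0 \<in> P2 \<Omega> \<T>" by (auto simp: P2_def zero_fun_def intro!: exI[of _ 0])
next
  fix f g assume f: "f \<in> P2 \<Omega> \<T>" and g: "g \<in> P2 \<Omega> \<T>"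
  have "\<exists>a b A. \<forall>x\<in>T. (f + g) x = a + b \<bullet> x + x \<bullet> (A *v x)" if T: "T \<in> \<T>" for T
  proof -
    obtain a b A where "\<And>x. x \<in> T \<Longrightarrow> f x = a + b \<bullet> x + x \<bullet> (A *v x)"
      using P2_quadratic[OF f T] by metis
    moreover obtain a' b' A' where "\<And>x. x \<in> T \<Longrightarrow> g x = a' + b' \<bullet> x + x \<bullet> (A' *v x)"
      using P2_quadratic[OF g T] by metis
    ultimately show ?thesis
      by (intro exI[of _ "a + a'"] exI[of _ "b + b'"] exI[of _ "A + A'"])
         (simp add: inner_add_left inner_add_right matrix_vector_mult_add_rdistrib)
  qed
  then show "f + g \<in> P2 \<Omega> \<T>" using f g by (auto simp: P2_def plus_fun_def intro: continuous_on_add)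
next
  fix c f assume f: "f \<in> P2 \<Omega> \<T>"
  have "\<exists>a b A. \<forall>x\<in>T. (c *\<^sub>R f) x = a + b \<bullet> x + x \<bullet> (A *v x)" if T: "T \<in> \<T>" for T
  proof -
    obtain a b A where "\<And>x. x \<in> T \<Longrightarrow> f x = a + b \<bullet> x + x \<bullet> (A *v x)"
      using P2_quadratic[OF f T] by metis
    then show ?thesis
      by (intro exI[of _ "c * a"] exI[of _ "c *\<^sub>R b"] exI[of _ "c *\<^sub>R A"])
         (simp add: algebra_simps scaleR_matrix_vector_assoc[symmetric])
  qed
  then show "c *\<^sub>R f \<in> P2 \<Omega> \<T>"
    using f by (auto simp: P2_def scaleR_fun_def intro: continuous_on_mult_left)
qed

lemma P2_grad:
  assumes "f \<in> P2 \<Omega> \<T>" "T \<in> \<T>"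
  obtains c B where "\<And>x. x \<in> interior T \<Longrightarrow> (f has_derivative (\<lambda>d. (c + 2 *\<^sub>R (symm B *v x)) \<bullet> d)) (at x)"
proof -
  obtain a b A where f: "\<And>x. x \<in> T \<Longrightarrow> f x = a + b \<bullet> x + x \<bullet> (A *v x)"
    using P2_quadratic[OF assms] by metis
  have "(f has_derivative (\<lambda>d. (b + 2 *\<^sub>R (symm A *v x)) \<bullet> d)) (at x)" if "x \<in> interior T" for x
    using open_interior that
    by (rule has_derivative_quadratic) (use f interior_subset in blast)
  then show ?thesis using that by blast
qed

lemma P2_differentiable:
  assumes "f \<in> P2 \<Omega> \<T>" "T \<in> \<T>" "x \<in> interior T"
  shows "f differentiable (at x)"
  using P2_grad[OF assms(1,2)] assms(3) by (metis differentiable_def)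

lemma piecewise_grad:
  assumes "f \<in> P2 \<Omega> \<T>"
  shows "piecewise (grad f)"
  unfolding piecewise_def
proof
  fix T assume T: "T \<in> \<T>"
  obtain c B where "\<And>x. x \<in> interior T \<Longrightarrow> (f has_derivative (\<lambda>d. (c + 2 *\<^sub>R (symm B *v x)) \<bullet> d)) (at x)"
    using P2_grad[OF assms T] by metis
  then have "\<forall>x\<in>interior T. grad f x = c + 2 *\<^sub>R (symm B *v x)" by (blast intro: grad_eqI)
  moreover have "continuous_on UNIV (\<lambda>x. c + 2 *\<^sub>R (symm B *v x))"
    by (intro continuous_intros linear_continuous_on matrix_vector_mul_bounded_linear)
  ultimately show "\<exists>g. continuous_on UNIV g \<and> (\<forall>x\<in>interior T. grad f x = g x)" by blast
qed

lemma a_G_sym: "a_G \<Omega> f g = a_G \<Omega> g f"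
  by (simp add: a_G_def inner_commute)

lemma a_G_add:
  assumes "f \<in> P2 \<Omega> \<T>" "g \<in> P2 \<Omega> \<T>" "k \<in> P2 \<Omega> \<T>"
  shows "a_G \<Omega> (f + g) k = a_G \<Omega> f k + a_G \<Omega> g k"
  unfolding a_G_def using assms
  by (intro integral_piecewise_add piecewise_inner piecewise_grad)
     (auto simp: grad_add P2_differentiable inner_add_left)

lemma a_G_scale:
  assumes "f \<in> P2 \<Omega> \<T>" "k \<in> P2 \<Omega> \<T>"
  shows "a_G \<Omega> (c *\<^sub>R f) k = c * a_G \<Omega> f k"
  unfolding a_G_def using assms
  by (intro integral_piecewise_scale piecewise_inner piecewise_grad)
     (auto simp: grad_scale P2_differentiable)

lemma a_G_nonneg: "0 \<le> a_G \<Omega> f f"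
  unfolding a_G_def set_lebesgue_integral_def by (intro Bochner_Integration.integral_nonneg) simp

lemma connected_domain: "connected (closure \<Omega>)"
  using convex_domain by (simp add: convex_closure convex_connected)

text \<open>A continuous function with finitely many values on a connected set is constant, and each
  triangle contributes one value.\<close>
lemma constant_of_piecewise_constant:
  fixes f :: "real^2 \<Rightarrow> real"
  assumes "continuous_on (closure \<Omega>) f" "\<And>T. T \<in> \<T> \<Longrightarrow> \<exists>c. \<forall>x\<in>T. f x = c"
  obtains c where "\<And>x. x \<in> closure \<Omega> \<Longrightarrow> f x = c"
proof -
  obtain c where "\<And>T x. \<lbrakk>T \<in> \<T>; x \<in> T\<rbrakk> \<Longrightarrow> f x = c T" using assms(2) by metis
  then have "f ` closure \<Omega> \<subseteq> c ` \<T>" using mesh_cover by blast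
  then have "finite (f ` closure \<Omega>)" using finite_mesh finite_surj by blast
  then show ?thesis
    using continuous_finite_range_constant[OF connected_domain assms(1)] that
    by (auto simp: constant_on_def)
qed

lemma a_G_zero:
  assumes f: "f \<in> P2 \<Omega> \<T>" and zero: "a_G \<Omega> f f = 0"
  obtains c where "\<And>x. x \<in> closure \<Omega> \<Longrightarrow> f x = c"
proof (rule constant_of_piecewise_constant)
  show cont: "continuous_on (closure \<Omega>) f" using f by (simp add: P2_def)
  fix T assume T: "T \<in> \<T>"
  have "(f has_derivative (\<lambda>d. 0)) (at x within interior T)" if x: "x \<in> interior T" for x
  proof -
    have "grad f x \<bullet> grad f x = 0"
      using piecewise_inner[OF piecewise_grad[OF f] piecewise_grad[OF f]] _ _ T x
      by (rule piecewise_integral_zero) (use zero in \<open>auto simp: a_G_def\<close>)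
    then show ?thesis
      using has_derivative_grad[OF P2_differentiable[OF f T x]] has_derivative_at_withinI by force
  qed
  then obtain c where c: "\<And>x. x \<in> interior T \<Longrightarrow> f x = c"
    using has_derivative_zero_constant[OF convex_interior[OF convex_triangle[OF T]], of f] by metis
  have "f x = c" if "x \<in> T" for x
    using continuous_constant_on_closure[of "interior T" f c x] c that closure_interior[OF T]
      continuous_on_subset[OF cont triangle_subset[OF T]] by simp
  then show "\<exists>c. \<forall>x\<in>T. f x = c" by blast
qed (use that in blast)

lemma V1_vec_V1: "u \<in> V1_vec \<Omega> \<T> \<Longrightarrow> (\<lambda>x. u x $ k) \<in> V1 \<Omega> \<T>"
  by (simp add: V1_vec_def)

lemma V1_vec_outside: "\<lbrakk>u \<in> V1_vec \<Omega> \<T>; x \<notin> closure \<Omega>\<rbrakk> \<Longrightarrow> u x = 0"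
  by (simp add: V1_vec_def V1_def vec_eq_iff)

lemma V1_vec_continuous: "u \<in> V1_vec \<Omega> \<T> \<Longrightarrow> continuous_on (closure \<Omega>) u"
  using continuous_on_vec_lambda[of "closure \<Omega>" "\<lambda>k x. u x $ k"] by (simp add: V1_vec_def V1_def)

lemma subspace_V1_vec: "subspace (V1_vec \<Omega> \<T>)"
proof (rule subspaceI)
  show "0 \<in> V1_vec \<Omega> \<T>" using subspace_0[OF subspace_V1] by (simp add: V1_vec_def zero_fun_def)
next
  fix u v assume "u \<in> V1_vec \<Omega> \<T>" "v \<in> V1_vec \<Omega> \<T>"
  then show "u + v \<in> V1_vec \<Omega> \<T>"
    using subspace_add[OF subspace_V1, of "\<lambda>x. u x $ k" "\<lambda>x. v x $ k" for k]
    by (simp add: V1_vec_def plus_fun_def)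
next
  fix c u assume "u \<in> V1_vec \<Omega> \<T>"
  then show "c *\<^sub>R u \<in> V1_vec \<Omega> \<T>"
    using subspace_scale[OF subspace_V1, of "\<lambda>x. u x $ k" c for k]
    by (simp add: V1_vec_def scaleR_fun_def)
qed

lemma V1_vec_affine:
  assumes "u \<in> V1_vec \<Omega> \<T>" "T \<in> \<T>"
  obtains a M where "\<And>x. x \<in> T \<Longrightarrow> u x = a + M *v x"
proof -
  have "\<forall>k. \<exists>ab. \<forall>x\<in>T. u x $ k = fst ab + snd ab \<bullet> x"
    using V1_affine[OF V1_vec_V1[OF assms(1)] assms(2)] by (metis fst_conv snd_conv)
  then obtain ab where ab: "\<And>k x. x \<in> T \<Longrightarrow> u x $ k = fst (ab k) + snd (ab k) \<bullet> x" by metis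
  have "u x = (\<chi> k. fst (ab k)) + (\<chi> k. snd (ab k)) *v x" if "x \<in> T" for x
    using ab[OF that] by (simp add: vec_eq_iff matrix_vector_mult_def inner_vec_def)
  then show ?thesis using that by blast
qed

lemma V1_vec_of_affine:
  assumes "\<And>T. T \<in> \<T> \<Longrightarrow> \<exists>a M. \<forall>x\<in>T. u x = a + M *v x"
    and "\<And>x. x \<notin> closure \<Omega> \<Longrightarrow> u x = 0"
  shows "u \<in> V1_vec \<Omega> \<T>"
proof -
  have "(\<lambda>x. u x $ k) \<in> V1 \<Omega> \<T>" for k
  proof -
    have *: "\<exists>a b. \<forall>x\<in>T. u x $ k = a + b \<bullet> x" if T: "T \<in> \<T>" for T
    proof -
      obtain a M where "\<forall>x\<in>T. u x = a + M *v x" using assms(1)[OF T] by blast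
      then have "\<forall>x\<in>T. u x $ k = a $ k + (M $ k) \<bullet> x"
        by (simp add: matrix_vector_mult_def inner_vec_def)
      then show ?thesis by blast
    qed
    moreover have "continuous_on (closure \<Omega>) (\<lambda>x. u x $ k)"
    proof (rule continuous_pieces)
      fix T assume "T \<in> \<T>"
      with * obtain a b where ab: "\<forall>x\<in>T. u x $ k = a + b \<bullet> x" by blast
      have "continuous_on T (\<lambda>x. a + b \<bullet> x)" by (intro continuous_intros)
      then show "continuous_on T (\<lambda>x. u x $ k)" using ab by (simp cong: continuous_on_cong)
    qed
    ultimately show ?thesis using assms(2) by (simp add: V1_def)
  qed
  then show ?thesis by (simp add: V1_vec_def)
qed

text \<open>All properties of the strain of a finite element function are read off from this formula.\<close>
lemma strain_affine:
  assumes u: "\<And>x. x \<in> T \<Longrightarrow> u x = a + M *v x" and x: "x \<in> interior T"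
  shows "strain u x = symm M"
proof -
  have "partial_deriv j (\<lambda>y. u y $ i) x = M $ i $ j" for i j
  proof -
    have "((\<lambda>y. u y $ i) has_derivative (\<lambda>d. (M $ i + 2 *\<^sub>R (symm 0 *v x)) \<bullet> d)) (at x)"
    proof (rule has_derivative_quadratic[OF open_interior x])
      fix y assume "y \<in> interior T"
      then have "y \<in> T" using interior_subset by blast
      then show "u y $ i = a $ i + M $ i \<bullet> y + y \<bullet> (0 *v y)"
        using u by (simp add: matrix_vector_mult_def inner_vec_def)
    qed
    then have "((\<lambda>y. u y $ i) has_derivative (\<lambda>d. M $ i \<bullet> d)) (at x)"
      using symm_scale[of 0 0] by simp
    then show ?thesis by (rule grad_eqI)
  qed
  then show ?thesis
    by (simp add: strain_def symm_def vec_eq_iff transpose_def)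
qed

lemma strain_add:
  assumes "u \<in> V1_vec \<Omega> \<T>" "v \<in> V1_vec \<Omega> \<T>" "T \<in> \<T>" "x \<in> interior T"
  shows "strain (u + v) x = strain u x + strain v x"
proof -
  obtain a M where u: "\<And>x. x \<in> T \<Longrightarrow> u x = a + M *v x" using V1_vec_affine assms by metis
  obtain b N where v: "\<And>x. x \<in> T \<Longrightarrow> v x = b + N *v x" using V1_vec_affine assms by metis
  have "\<And>x. x \<in> T \<Longrightarrow> (u + v) x = (a + b) + (M + N) *v x"
    using u v by (simp add: matrix_vector_mult_add_rdistrib)
  then show ?thesis
    using strain_affine[OF u assms(4)] strain_affine[OF v assms(4)] strain_affine[OF _ assms(4)]
    by (metis symm_add)
qed

lemma strain_scale:
  assumes "u \<in> V1_vec \<Omega> \<T>" "T \<in> \<T>" "x \<in> interior T"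
  shows "strain (c *\<^sub>R u) x = c *\<^sub>R strain u x"
proof -
  obtain a M where u: "\<And>x. x \<in> T \<Longrightarrow> u x = a + M *v x" using V1_vec_affine assms by metis
  have "\<And>x. x \<in> T \<Longrightarrow> (c *\<^sub>R u) x = c *\<^sub>R a + (c *\<^sub>R M) *v x"
    using u by (simp add: scaleR_right_distrib scaleR_matrix_vector_assoc)
  then show ?thesis
    using strain_affine[OF u assms(3)] strain_affine[OF _ assms(3)] by (metis symm_scale)
qed

lemma piecewise_strain:
  assumes "u \<in> V1_vec \<Omega> \<T>"
  shows "piecewise (strain u)"
  unfolding piecewise_def
proof
  fix T assume "T \<in> \<T>"
  then obtain a M where "\<And>x. x \<in> T \<Longrightarrow> u x = a + M *v x" using V1_vec_affine assms by metis
  then have "\<forall>x\<in>interior T. strain u x = symm M" by (blast intro: strain_affine)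
  then show "\<exists>g. continuous_on UNIV g \<and> (\<forall>x\<in>interior T. strain u x = g x)"
    by (intro exI[of _ "\<lambda>x. symm M"]) auto
qed

lemma piecewise_divergence:
  assumes "u \<in> V1_vec \<Omega> \<T>"
  shows "piecewise (divergence u)"
  using piecewise_compose2[OF piecewise_strain[OF assms] piecewise_strain[OF assms],
      of "\<lambda>A B. \<Sum>k\<in>UNIV. A $ k $ k"]
  by (simp add: divergence_strain[abs_def] continuous_intros)

definition a_div :: "(real^2 \<Rightarrow> real^2) \<Rightarrow> (real^2 \<Rightarrow> real^2) \<Rightarrow> real" where
  "a_div u v = (LINT x:\<Omega>|lebesgue. divergence u x * divergence v x)"

lemma a_W_eq: "a_W \<Omega> u v = (LINT x:\<Omega>|lebesgue. strain u x \<bullet> strain v x)"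
  by (simp add: a_W_def frobenius_inner)

lemma a_LE_eq:
  assumes "u \<in> V1_vec \<Omega> \<T>" "v \<in> V1_vec \<Omega> \<T>"
  shows "a_LE \<Omega> E \<nu> u v = 2 * lame_mu E \<nu> * a_W \<Omega> u v + lame_lambda E \<nu> * a_div u v"
proof -
  let ?w = "\<lambda>x. strain u x \<bullet> strain v x" and ?d = "\<lambda>x. divergence u x * divergence v x"
  have w: "piecewise ?w" "piecewise ?d"
    using assms by (auto intro: piecewise_inner piecewise_mult piecewise_strain piecewise_divergence)
  have "a_LE \<Omega> E \<nu> u v = (LINT x:\<Omega>|lebesgue. 2 * lame_mu E \<nu> * ?w x)
      + (LINT x:\<Omega>|lebesgue. lame_lambda E \<nu> * ?d x)"
    unfolding a_LE_def
    by (intro integral_piecewise_add piecewise_mult[OF piecewise_const w(1)] piecewise_mult[OF piecewise_const w(2)])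
       (simp add: frobenius_inner mult.assoc)
  then show ?thesis by (simp add: a_W_eq a_div_def)
qed

lemma a_W_sym: "a_W \<Omega> u v = a_W \<Omega> v u"
  by (simp add: a_W_eq inner_commute)

lemma a_W_add:
  assumes "u \<in> V1_vec \<Omega> \<T>" "v \<in> V1_vec \<Omega> \<T>" "w \<in> V1_vec \<Omega> \<T>"
  shows "a_W \<Omega> (u + v) w = a_W \<Omega> u w + a_W \<Omega> v w"
  unfolding a_W_eq using assms
  by (intro integral_piecewise_add piecewise_inner piecewise_strain) (auto simp: strain_add inner_add_left)

lemma a_W_scale:
  assumes "u \<in> V1_vec \<Omega> \<T>" "w \<in> V1_vec \<Omega> \<T>"
  shows "a_W \<Omega> (c *\<^sub>R u) w = c * a_W \<Omega> u w"
  unfolding a_W_eq using assms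
  by (intro integral_piecewise_scale piecewise_inner piecewise_strain) (auto simp: strain_scale)

lemma a_div_add:
  assumes "u \<in> V1_vec \<Omega> \<T>" "v \<in> V1_vec \<Omega> \<T>" "w \<in> V1_vec \<Omega> \<T>"
  shows "a_div (u + v) w = a_div u w + a_div v w"
  unfolding a_div_def using assms
  by (intro integral_piecewise_add piecewise_mult piecewise_divergence)
     (auto simp: divergence_strain strain_add sum.distrib distrib_right)

lemma a_div_scale:
  assumes "u \<in> V1_vec \<Omega> \<T>" "w \<in> V1_vec \<Omega> \<T>"
  shows "a_div (c *\<^sub>R u) w = c * a_div u w"
  unfolding a_div_def using assms
  by (intro integral_piecewise_scale piecewise_mult piecewise_divergence)
     (auto simp: divergence_strain strain_scale sum_distrib_left[symmetric] mult.assoc)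

lemma a_div_nonneg: "0 \<le> a_div u u"
  unfolding a_div_def set_lebesgue_integral_def by (intro Bochner_Integration.integral_nonneg) simp

lemma a_div_le:
  assumes "u \<in> V1_vec \<Omega> \<T>"
  shows "a_div u u \<le> 2 * a_W \<Omega> u u"
proof -
  have "a_div u u \<le> (LINT x:\<Omega>|lebesgue. 2 * (strain u x \<bullet> strain u x))"
    unfolding a_div_def
  proof (rule integral_piecewise_mono)
    show "divergence u x * divergence u x \<le> 2 * (strain u x \<bullet> strain u x)" for x
      using trace_power2_le[of "strain u x"] by (simp only: divergence_strain power2_eq_square)
  qed (intro piecewise_mult[OF piecewise_const] piecewise_mult piecewise_divergence
      piecewise_inner piecewise_strain assms)+
  then show ?thesis by (simp add: a_W_eq)
qed

end

section \<open>Spectral equivalence of the two energies\<close>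

context shape_regular_mesh
begin

text \<open>Since \<open>\<psi>\<close> is \<open>(x - p) / h\<close>, the part of the sum with \<open>x\<close> reproduces \<open>u \<bullet> x\<close> and the part with
  \<open>p\<close> interpolates it: \<open>\<Pi>\<close> is a scaled interpolation error.\<close>
lemma Pi_G_eq:
  assumes u: "u \<in> V1_vec \<Omega> \<T>"
  shows "Pi_G \<Omega> \<T> u x = (u x \<bullet> x - interp (\<lambda>p. u p \<bullet> p) x) / h"
proof -
  let ?\<phi> = "nodal_basis \<Omega> \<T>"
  have "Pi_G \<Omega> \<T> u x = (\<Sum>k\<in>UNIV. \<Sum>p\<in>vertices \<T>. u p $ k * psi \<T> k p x * ?\<phi> p x)"
    unfolding Pi_G_def by (simp add: nodal_coeff V1_vec_V1[OF u])
  also have "\<dots> = (\<Sum>k\<in>UNIV. (x $ k * interp (\<lambda>p. u p $ k) x - interp (\<lambda>p. u p $ k * p $ k) x) / h)"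
    by (simp add: interp_apply psi_def sum_distrib_left sum_subtractf[symmetric] sum_divide_distrib
        algebra_simps diff_divide_distrib)
  also have "\<dots> = (\<Sum>k\<in>UNIV. x $ k * u x $ k) / h - (\<Sum>k\<in>UNIV. interp (\<lambda>p. u p $ k * p $ k) x) / h"
    by (simp add: interp_V1[OF V1_vec_V1[OF u]] diff_divide_distrib sum_subtractf sum_divide_distrib)
  also have "(\<Sum>k\<in>UNIV. interp (\<lambda>p. u p $ k * p $ k) x) = interp (\<lambda>p. u p \<bullet> p) x"
    by (simp add: sum_2 interp_add[symmetric] inner_vec_def flip: plus_fun_apply)
  also have "(\<Sum>k\<in>UNIV. x $ k * u x $ k) = u x \<bullet> x"
    by (simp add: inner_vec_def mult.commute)
  finally show ?thesis by (simp add: diff_divide_distrib)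
qed

lemma Pi_G_add:
  assumes "u \<in> V1_vec \<Omega> \<T>" "v \<in> V1_vec \<Omega> \<T>"
  shows "Pi_G \<Omega> \<T> (u + v) = Pi_G \<Omega> \<T> u + Pi_G \<Omega> \<T> v"
proof
  fix x
  have "interp (\<lambda>p. (u + v) p \<bullet> p) = interp (\<lambda>p. u p \<bullet> p) + interp (\<lambda>p. v p \<bullet> p)"
    unfolding interp_add[symmetric] by (simp add: inner_add_left)
  then show "Pi_G \<Omega> \<T> (u + v) x = (Pi_G \<Omega> \<T> u + Pi_G \<Omega> \<T> v) x"
    using assms by (simp add: Pi_G_eq subspace_add[OF subspace_V1_vec] inner_add_left
        add_divide_distrib diff_divide_distrib)
qed

lemma Pi_G_scale:
  assumes "u \<in> V1_vec \<Omega> \<T>"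
  shows "Pi_G \<Omega> \<T> (c *\<^sub>R u) = c *\<^sub>R Pi_G \<Omega> \<T> u"
proof
  fix x
  have "interp (\<lambda>p. (c *\<^sub>R u) p \<bullet> p) = c *\<^sub>R interp (\<lambda>p. u p \<bullet> p)"
    unfolding interp_scale[symmetric] by simp
  then show "Pi_G \<Omega> \<T> (c *\<^sub>R u) x = (c *\<^sub>R Pi_G \<Omega> \<T> u) x"
    using assms by (simp add: Pi_G_eq subspace_scale[OF subspace_V1_vec] diff_divide_distrib right_diff_distrib)
qed

lemma Pi_G_local:
  assumes "u \<in> V1_vec \<Omega> \<T>" "T \<in> \<T>"
  obtains a M \<alpha> g where "\<And>x. x \<in> T \<Longrightarrow> u x = a + M *v x"
    and "\<And>x. x \<in> T \<Longrightarrow> Pi_G \<Omega> \<T> u x = (\<alpha> + g \<bullet> x + x \<bullet> (M *v x)) / h"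
    and "\<And>p. p \<in> corners T \<Longrightarrow> \<alpha> + g \<bullet> p + p \<bullet> (M *v p) = 0"
proof -
  obtain a M where u: "\<And>x. x \<in> T \<Longrightarrow> u x = a + M *v x" using V1_vec_affine[OF assms] by metis
  obtain \<beta> b where b: "\<And>x. x \<in> T \<Longrightarrow> interp (\<lambda>p. u p \<bullet> p) x = \<beta> + b \<bullet> x"
    using V1_affine[OF interp_in_V1 assms(2)] by metis
  have eq: "u x \<bullet> x - interp (\<lambda>p. u p \<bullet> p) x = - \<beta> + (a - b) \<bullet> x + x \<bullet> (M *v x)" if "x \<in> T" for x
    using u[OF that] b[OF that]
    by (simp add: inner_diff_left inner_add_left inner_commute[of "M *v x"])
  show ?thesis
  proof (rule that[OF u])
    show "Pi_G \<Omega> \<T> u x = (- \<beta> + (a - b) \<bullet> x + x \<bullet> (M *v x)) / h" if "x \<in> T" for x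
      using eq[OF that] by (simp add: Pi_G_eq[OF assms(1)])
    show "- \<beta> + (a - b) \<bullet> p + p \<bullet> (M *v p) = 0" if "p \<in> corners T" for p
    proof -
      have p: "p \<in> T" "p \<in> vertices \<T>"
        using that corners_subset[OF assms(2)] corners_vertices[OF assms(2)] by blast+
      show ?thesis using eq[OF p(1)] interp_vertex[OF p(2)] by simp
    qed
  qed
qed

lemma Pi_G_P2:
  assumes u: "u \<in> V1_vec \<Omega> \<T>"
  shows "Pi_G \<Omega> \<T> u \<in> P2 \<Omega> \<T>"
proof -
  have J: "interp (\<lambda>p. u p \<bullet> p) \<in> V1 \<Omega> \<T>" by (rule interp_in_V1)
  have "continuous_on (closure \<Omega>) (\<lambda>x. (u x \<bullet> x - interp (\<lambda>p. u p \<bullet> p) x) / h)"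
    using mesh_size_pos J V1_vec_continuous[OF u]
    by (intro continuous_intros) (auto simp: V1_def)
  then have "continuous_on (closure \<Omega>) (Pi_G \<Omega> \<T> u)" by (simp add: Pi_G_eq[OF u, abs_def])
  moreover have "Pi_G \<Omega> \<T> u x = 0" if "x \<notin> closure \<Omega>" for x
    using J that V1_vec_outside[OF u that] by (simp add: Pi_G_eq[OF u] V1_def)
  moreover have "\<exists>a b A. \<forall>x\<in>T. Pi_G \<Omega> \<T> u x = a + b \<bullet> x + x \<bullet> (A *v x)" if T: "T \<in> \<T>" for T
  proof -
    obtain a M \<alpha> g where *: "\<And>x. x \<in> T \<Longrightarrow> Pi_G \<Omega> \<T> u x = (\<alpha> + g \<bullet> x + x \<bullet> (M *v x)) / h"
      using Pi_G_local[OF u T] by metis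
    show ?thesis
      by (intro exI[of _ "\<alpha> / h"] exI[of _ "(1 / h) *\<^sub>R g"] exI[of _ "(1 / h) *\<^sub>R M"])
         (simp add: * add_divide_distrib scaleR_matrix_vector_assoc[symmetric])
  qed
  ultimately show ?thesis by (simp add: P2_def)
qed

lemma Pi_G_grad:
  assumes "\<And>x. x \<in> T \<Longrightarrow> Pi_G \<Omega> \<T> u x = (\<alpha> + g \<bullet> x + x \<bullet> (M *v x)) / h"
    and x: "x \<in> interior T"
  shows "grad (Pi_G \<Omega> \<T> u) x = (1 / h) *\<^sub>R (g + 2 *\<^sub>R (symm M *v x))"
proof -
  have "(Pi_G \<Omega> \<T> u has_derivative
      (\<lambda>d. ((1 / h) *\<^sub>R g + 2 *\<^sub>R (symm ((1 / h) *\<^sub>R M) *v x)) \<bullet> d)) (at x)"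
  proof (rule has_derivative_quadratic[OF open_interior x])
    fix y assume "y \<in> interior T"
    then have "y \<in> T" using interior_subset by blast
    then show "Pi_G \<Omega> \<T> u y = \<alpha> / h + (1 / h) *\<^sub>R g \<bullet> y + y \<bullet> ((1 / h) *\<^sub>R M *v y)"
      using assms(1) by (simp add: add_divide_distrib scaleR_matrix_vector_assoc[symmetric])
  qed
  from grad_eqI(1)[OF this] show ?thesis
    by (simp add: symm_scale scaleR_matrix_vector_assoc[symmetric] scaleR_right_distrib)
qed

text \<open>Here \<open>quadratic_gradient_upper\<close> is applied with diameter \<open>h\<close> and radius \<open>\<rho> h\<close>; the powers of
  \<open>h\<close> cancel against the factor \<open>1/h\<close> in \<open>\<Pi>\<close>.\<close>
lemma Pi_G_grad_le:
  assumes u: "u \<in> V1_vec \<Omega> \<T>" and T: "T \<in> \<T>" and x: "x \<in> interior T"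
  shows "norm (grad (Pi_G \<Omega> \<T> u) x) \<le> (4 / \<rho> + 2) * norm (strain u x)"
proof -
  obtain a M \<alpha> g where ua: "\<And>x. x \<in> T \<Longrightarrow> u x = a + M *v x"
    and Pi: "\<And>x. x \<in> T \<Longrightarrow> Pi_G \<Omega> \<T> u x = (\<alpha> + g \<bullet> x + x \<bullet> (M *v x)) / h"
    and zero: "\<And>p. p \<in> corners T \<Longrightarrow> \<alpha> + g \<bullet> p + p \<bullet> (M *v p) = 0"
    using Pi_G_local[OF u T] by metis
  obtain c where c: "ball c (\<rho> * h) \<subseteq> T" using balls[OF T] by blast
  obtain p0 where p0: "p0 \<in> corners T" using corners_nonempty[OF T] by blast
  have "norm (g + 2 *\<^sub>R (symm M *v x)) \<le> (4 * h\<^sup>2 / (\<rho> * h) + 2 * h) * norm (symm M)"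
    by (rule quadratic_gradient_upper[OF _ p0, of _ _ c _ \<alpha>])
       (use triangle_simplex(4)[OF T] x interior_subset dist_triangle_le[OF T] c radius_pos zero in auto)
  then have "norm (g + 2 *\<^sub>R (symm M *v x)) \<le> h * ((4 / \<rho> + 2) * norm (symm M))"
    using mesh_size_pos rho_pos by (simp add: field_simps power2_eq_square)
  moreover have "grad (Pi_G \<Omega> \<T> u) x = (1 / h) *\<^sub>R (g + 2 *\<^sub>R (symm M *v x))"
    by (rule Pi_G_grad[OF _ x]) (rule Pi)
  moreover have "strain u x = symm M" by (rule strain_affine[OF _ x]) (rule ua)
  ultimately show ?thesis
    using mesh_size_pos by (simp add: divide_le_eq mult.commute)
qed

lemma a_G_Pi_G_le:
  assumes u: "u \<in> V1_vec \<Omega> \<T>"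
  shows "a_G \<Omega> (Pi_G \<Omega> \<T> u) (Pi_G \<Omega> \<T> u) \<le> (4 / \<rho> + 2)\<^sup>2 * a_W \<Omega> u u"
proof -
  let ?K = "(4 / \<rho> + 2)\<^sup>2"
  have pw: "piecewise (\<lambda>x. strain u x \<bullet> strain u x)"
    by (rule piecewise_inner[OF piecewise_strain[OF u] piecewise_strain[OF u]])
  have pg: "piecewise (\<lambda>x. grad (Pi_G \<Omega> \<T> u) x \<bullet> grad (Pi_G \<Omega> \<T> u) x)"
    by (rule piecewise_inner[OF piecewise_grad[OF Pi_G_P2[OF u]] piecewise_grad[OF Pi_G_P2[OF u]]])
  have "a_G \<Omega> (Pi_G \<Omega> \<T> u) (Pi_G \<Omega> \<T> u) \<le> (LINT x:\<Omega>|lebesgue. ?K * (strain u x \<bullet> strain u x))"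
    unfolding a_G_def
  proof (rule integral_piecewise_mono[OF pg piecewise_mult[OF piecewise_const pw]])
    fix T x assume "T \<in> \<T>" "x \<in> interior T"
    then have "(norm (grad (Pi_G \<Omega> \<T> u) x))\<^sup>2 \<le> ((4 / \<rho> + 2) * norm (strain u x))\<^sup>2"
      using Pi_G_grad_le[OF u] by (intro power_mono) auto
    then show "grad (Pi_G \<Omega> \<T> u) x \<bullet> grad (Pi_G \<Omega> \<T> u) x \<le> ?K * (strain u x \<bullet> strain u x)"
      by (simp add: power_mult_distrib power2_norm_eq_inner)
  qed
  then show ?thesis by (simp add: a_W_eq)
qed

text \<open>The strain is constant and the triangle lies in a disc of radius \<open>h\<close>, which bounds the left
  integral by \<open>\<bar>\<epsilon>\<bar>\<^sup>2 h\<^sup>2 m\<close> with the area \<open>m\<close> of the unit disc. On a disc of radius \<open>\<rho> h / 8\<close> the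
  gradient of \<open>\<Pi> u\<close> has length at least \<open>\<rho> \<bar>\<epsilon>\<bar> / 10\<close> by \<open>affine_field_lower\<close>. Comparing the two
  areas gives \<open>100 / \<rho>\<^sup>2\<close> times \<open>64 / \<rho>\<^sup>2\<close>.\<close>
lemma triangle_strain_le:
  assumes u: "u \<in> V1_vec \<Omega> \<T>" and T: "T \<in> \<T>"
  shows "(LINT x:interior T|lebesgue. strain u x \<bullet> strain u x)
    \<le> 6400 / \<rho>^4 * (LINT x:interior T|lebesgue. grad (Pi_G \<Omega> \<T> u) x \<bullet> grad (Pi_G \<Omega> \<T> u) x)"
proof -
  obtain a M \<alpha> g where ua: "\<And>x. x \<in> T \<Longrightarrow> u x = a + M *v x"
    and Pi: "\<And>x. x \<in> T \<Longrightarrow> Pi_G \<Omega> \<T> u x = (\<alpha> + g \<bullet> x + x \<bullet> (M *v x)) / h"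
    using Pi_G_local[OF u T] by metis
  define N where "N = (norm (symm M))\<^sup>2"
  define m where "m = measure lborel (ball (0 :: real^2) 1)"
  define r where "r = \<rho> * h"
  have r: "0 < r" using radius_pos by (simp add: r_def)
  have lm: "interior T \<in> lmeasurable"
    using compact_triangle[OF T] by (simp add: bounded_interior compact_imp_bounded lmeasurable_open)

  obtain p where p: "p \<in> T" using interior_nonempty[OF T] interior_subset by blast
  have "interior T \<subseteq> cball p h"
    using dist_triangle_le[OF T p] interior_subset[of T] by (auto simp: dist_norm)
  then have "measure lebesgue (interior T) \<le> measure lebesgue (cball p h)"
    using lm by (intro measure_mono_fmeasurable) (auto simp: fmeasurableD)
  also have "\<dots> = h\<^sup>2 * m"
    using content_cball_conv_ball[of p h] content_ball_conv_unit_ball[of h p] mesh_size_pos by (simp add: m_def)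
  finally have area: "measure lebesgue (interior T) \<le> h\<^sup>2 * m" .
  have "(LINT x:interior T|lebesgue. strain u x \<bullet> strain u x) = (LINT x:interior T|lebesgue. N)"
    using strain_affine[of T u a M] ua
    by (intro set_lebesgue_integral_cong) (auto simp: N_def power2_norm_eq_inner lm fmeasurableD)
  also have "\<dots> = N * measure lebesgue (interior T)"
    using lm by (simp add: set_lebesgue_integral_def mult.commute)
  also have "\<dots> \<le> N * (h\<^sup>2 * m)" using area by (intro mult_left_mono) (auto simp: N_def)
  finally have left: "(LINT x:interior T|lebesgue. strain u x \<bullet> strain u x) \<le> N * (h\<^sup>2 * m)" .

  obtain c where c: "ball c r \<subseteq> T" using balls[OF T] unfolding r_def by blast
  obtain y where y: "ball y (r / 8) \<subseteq> ball c r"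
    and low: "\<And>x. x \<in> ball y (r / 8) \<Longrightarrow> r / 20 * norm (2 *\<^sub>R symm M) \<le> norm (g + (2 *\<^sub>R symm M) *v x)"
    using affine_field_lower[OF r, of c "2 *\<^sub>R symm M" g] by metis
  have ballT: "ball y (r / 8) \<subseteq> interior T" using y c by (intro interior_maximal) auto
  define K where "K = r\<^sup>2 / 100 * N / h\<^sup>2"
  have K: "K \<le> grad (Pi_G \<Omega> \<T> u) x \<bullet> grad (Pi_G \<Omega> \<T> u) x" if x: "x \<in> ball y (r / 8)" for x
  proof -
    have le: "(r / 20 * norm (2 *\<^sub>R symm M))\<^sup>2 \<le> (norm (g + 2 *\<^sub>R (symm M *v x)))\<^sup>2"
      using low[OF x] r by (intro power_mono) (auto simp: scaleR_matrix_vector_assoc)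
    have eq: "(r / 20 * norm (2 *\<^sub>R symm M))\<^sup>2 = r\<^sup>2 / 100 * N"
      by (simp add: N_def power2_eq_square)
    have sq: "grad (Pi_G \<Omega> \<T> u) x \<bullet> grad (Pi_G \<Omega> \<T> u) x = (norm (g + 2 *\<^sub>R (symm M *v x)))\<^sup>2 / h\<^sup>2"
    proof -
      have "grad (Pi_G \<Omega> \<T> u) x = (1 / h) *\<^sub>R (g + 2 *\<^sub>R (symm M *v x))"
        by (rule Pi_G_grad[OF _ subsetD[OF ballT x]]) (rule Pi)
      then show ?thesis by (simp add: power2_norm_eq_inner power2_eq_square[of h])
    qed
    show ?thesis
      unfolding K_def sq using le[unfolded eq] by (rule divide_right_mono) simp
  qed
  have int: "set_integrable lebesgue (interior T) (\<lambda>x. grad (Pi_G \<Omega> \<T> u) x \<bullet> grad (Pi_G \<Omega> \<T> u) x)"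
    using T by (intro integrable_triangle piecewise_inner piecewise_grad Pi_G_P2 u)
  have "K * ((r / 8)\<^sup>2 * m) = K * measure lebesgue (ball y (r / 8))"
    using content_ball_conv_unit_ball[of "r / 8" y] r by (simp add: m_def)
  also have "\<dots> = (LINT x:ball y (r / 8)|lebesgue. K)"
    by (simp add: set_lebesgue_integral_def mult.commute)
  also have "\<dots> \<le> (LINT x:ball y (r / 8)|lebesgue. grad (Pi_G \<Omega> \<T> u) x \<bullet> grad (Pi_G \<Omega> \<T> u) x)"
    using K set_integrable_subset[OF int _ ballT]
    by (intro set_integral_mono absolutely_integrable_on_const lmeasurable_ball) auto
  also have "\<dots> \<le> (LINT x:interior T|lebesgue. grad (Pi_G \<Omega> \<T> u) x \<bullet> grad (Pi_G \<Omega> \<T> u) x)"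
    unfolding set_lebesgue_integral_def
    using set_integrable_subset[OF int _ ballT] int ballT
    by (intro Bochner_Integration.integral_mono) (auto simp: set_integrable_def indicator_def)
  finally have right: "K * ((r / 8)\<^sup>2 * m)
    \<le> (LINT x:interior T|lebesgue. grad (Pi_G \<Omega> \<T> u) x \<bullet> grad (Pi_G \<Omega> \<T> u) x)" .
  have "N * (h\<^sup>2 * m) = 6400 / \<rho>^4 * (K * ((r / 8)\<^sup>2 * m))"
    using rho_pos mesh_size_pos
    by (simp add: K_def r_def field_simps power2_eq_square power4_eq_xxxx)
  also have "\<dots> \<le> 6400 / \<rho>^4 * (LINT x:interior T|lebesgue. grad (Pi_G \<Omega> \<T> u) x \<bullet> grad (Pi_G \<Omega> \<T> u) x)"
    using right rho_pos by (intro mult_left_mono) auto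
  finally show ?thesis using left by linarith
qed

lemma a_W_le_a_G:
  assumes u: "u \<in> V1_vec \<Omega> \<T>"
  shows "a_W \<Omega> u u \<le> 6400 / \<rho>^4 * a_G \<Omega> (Pi_G \<Omega> \<T> u) (Pi_G \<Omega> \<T> u)"
proof -
  have pw: "piecewise (\<lambda>x. strain u x \<bullet> strain u x)"
    by (rule piecewise_inner[OF piecewise_strain[OF u] piecewise_strain[OF u]])
  have pg: "piecewise (\<lambda>x. grad (Pi_G \<Omega> \<T> u) x \<bullet> grad (Pi_G \<Omega> \<T> u) x)"
    by (rule piecewise_inner[OF piecewise_grad[OF Pi_G_P2[OF u]] piecewise_grad[OF Pi_G_P2[OF u]]])
  show ?thesis
    unfolding a_W_eq a_G_def integral_sum_triangles[OF pw] integral_sum_triangles[OF pg] sum_distrib_left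
    by (intro sum_mono triangle_strain_le u)
qed

end

section \<open>Rigid displacements and their orthogonal complement\<close>

lemma finite_dim_inner_on_subspace:
  assumes "finite_dim_inner_on V b" "subspace U" "U \<subseteq> V"
  shows "finite_dim_inner_on U b"
proof -
  interpret finite_dim_inner_on V b by fact
  show ?thesis
  proof
    show "\<exists>B. finite B \<and> U \<subseteq> span B" using finite_dim assms(3) by blast
    show "b (x + y) z = b x z + b y z" if "x \<in> U" "y \<in> U" "z \<in> U" for x y z
      using that assms(3) by (intro add) auto
    show "b (c *\<^sub>R x) z = c * b x z" if "x \<in> U" "z \<in> U" for c x z
      using that assms(3) by (intro scale) auto
    show "b x y = b y x" if "x \<in> U" "y \<in> U" for x y
      using that assms(3) by (intro sym) auto
    show "0 < b x x" if "x \<in> U" "x \<noteq> 0" for x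
      using that assms(3) by (intro pos) auto
  qed fact
qed

lemma skew_mult:
  assumes "symm M = 0"
  shows "M *v x = M $ 2 $ 1 *\<^sub>R vector [- (x $ 2), x $ 1]"
proof -
  have "M $ 1 $ 1 = 0" "M $ 2 $ 2 = 0" "M $ 1 $ 2 = - M $ 2 $ 1"
    using assms by (auto simp: symm_def vec_eq_iff forall_2 transpose_def)
  then show ?thesis
    by (simp add: vec_eq_iff forall_2 matrix_vector_mult_def sum_2 vector_2)
qed

lemma rot_mult:
  "b *\<^sub>R (vector [- (x $ 2), x $ 1] :: real^2) = (vector [vector [0, - b], vector [b, 0]] :: real^2^2) *v x"
  by (simp add: vec_eq_iff forall_2 matrix_vector_mult_def sum_2 vector_2)

lemma rigid_modesI: "(\<lambda>x. a + b *\<^sub>R vector [- (x $ 2), x $ 1]) \<in> rigid_modes"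
  unfolding rigid_modes_def by blast

lemma rot_orthogonal: "vector [- (x $ 2), x $ 1] \<bullet> (x :: real^2) = 0"
  by (simp add: inner_vec_def sum_2 vector_2)

context shape_regular_mesh
begin

lemma continuous_zero_on_mesh:
  fixes f :: "real^2 \<Rightarrow> 'b::real_normed_vector"
  assumes "continuous_on (closure \<Omega>) f" "\<And>T x. \<lbrakk>T \<in> \<T>; x \<in> interior T\<rbrakk> \<Longrightarrow> f x = 0"
    and "x \<in> closure \<Omega>"
  shows "f x = 0"
proof -
  obtain T where T: "T \<in> \<T>" "x \<in> T" using mesh_cover assms(3) by blast
  show ?thesis
    using continuous_constant_on_closure[of "interior T" f 0 x] assms(2)[OF T(1)] T
      closure_interior[OF T(1)] continuous_on_subset[OF assms(1) triangle_subset[OF T(1)]] by simp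
qed

text \<open>Along the segment from \<open>y\<close> to \<open>x\<close>, which stays in the convex domain, the component of \<open>u\<close> in the
  direction of the segment is constant on every triangle, because the strain vanishes there. It is
  also continuous and takes finitely many values, hence it is constant.\<close>
lemma strain_zero_orthogonal:
  assumes u: "u \<in> V1_vec \<Omega> \<T>" and zero: "\<And>T x. \<lbrakk>T \<in> \<T>; x \<in> interior T\<rbrakk> \<Longrightarrow> strain u x = 0"
    and x: "x \<in> closure \<Omega>" and y: "y \<in> closure \<Omega>"
  shows "(u x - u y) \<bullet> (x - y) = 0"
proof -
  let ?S = "closed_segment y x" and ?f = "\<lambda>z. u z \<bullet> (x - y)"
  have S: "?S \<subseteq> closure \<Omega>"
    using x y convex_domain by (simp add: closed_segment_subset convex_closure)
  have local: "?f p = ?f q" if T: "T \<in> \<T>" and pq: "p \<in> T \<inter> ?S" "q \<in> T \<inter> ?S" for T p q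
  proof -
    obtain a M where ua: "\<And>x. x \<in> T \<Longrightarrow> u x = a + M *v x" using V1_vec_affine[OF u T] by metis
    obtain i where i: "i \<in> interior T" using interior_nonempty[OF T] by blast
    have "strain u i = symm M" by (rule strain_affine[OF _ i]) (rule ua)
    then have "symm M = 0" using zero[OF T i] by simp
    obtain s where s: "p - q = s *\<^sub>R (x - y)"
    proof -
      obtain s t where p: "p = (1 - s) *\<^sub>R y + s *\<^sub>R x" and q: "q = (1 - t) *\<^sub>R y + t *\<^sub>R x"
        using pq by (auto simp: in_segment)
      have "p - q = (s - t) *\<^sub>R (x - y)" unfolding p q by (simp add: algebra_simps)
      then show ?thesis using that by blast
    qed
    have "u p - u q = s *\<^sub>R (M *v (x - y))"
      using ua pq s by (simp add: matrix_vector_mult_diff_distrib[symmetric] matrix_vector_mult_scaleR)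
    then have "(u p - u q) \<bullet> (x - y) = 0"
      using \<open>symm M = 0\<close> symm_quadratic[of "x - y" M] by (simp add: inner_commute)
    then show ?thesis by (simp add: inner_diff_left)
  qed
  define c where "c T = ?f (SOME z. z \<in> T \<inter> ?S)" for T
  have "?f z \<in> c ` \<T>" if z: "z \<in> ?S" for z
  proof -
    obtain T where T: "T \<in> \<T>" "z \<in> T" using mesh_cover z S by blast
    then have zT: "z \<in> T \<inter> ?S" using z by blast
    have "?f z = c T"
      unfolding c_def by (rule local[OF T(1) zT]) (rule someI[of "\<lambda>z. z \<in> T \<inter> ?S", OF zT])
    then show ?thesis using T by blast
  qed
  then have fin: "finite (?f ` ?S)" using finite_mesh by (meson finite_imageI finite_subset image_subsetI)
  have cont: "continuous_on ?S ?f"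
    by (intro continuous_intros continuous_on_subset[OF V1_vec_continuous[OF u] S])
  have "?f constant_on ?S"
    by (rule continuous_finite_range_constant[OF connected_segment(1) cont fin])
  then have "?f x = ?f y" by (auto simp: constant_on_def)
  then show ?thesis by (simp add: inner_diff_left)
qed

text \<open>On one triangle \<open>u\<close> is an affine map with a skew matrix. The difference \<open>w\<close> between \<open>u x\<close> and
  this affine map at an arbitrary \<open>x\<close> is orthogonal to \<open>x - y\<close> for all \<open>y\<close> in the triangle by
  \<open>strain_zero_orthogonal\<close>; these vectors span the plane, so \<open>w\<close> vanishes.\<close>
lemma strain_zero_rigid:
  assumes u: "u \<in> V1_vec \<Omega> \<T>" and zero: "\<And>T x. \<lbrakk>T \<in> \<T>; x \<in> interior T\<rbrakk> \<Longrightarrow> strain u x = 0"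
  obtains v where "v \<in> rigid_modes" "\<And>x. x \<in> closure \<Omega> \<Longrightarrow> u x = v x"
proof -
  obtain z where "z \<in> closure \<Omega>" using domain_nonempty closure_subset by blast
  then obtain T where T: "T \<in> \<T>" using mesh_cover by blast
  obtain a M where ua: "\<And>x. x \<in> T \<Longrightarrow> u x = a + M *v x" using V1_vec_affine[OF u T] by metis
  obtain p where p: "p \<in> interior T" using interior_nonempty[OF T] by blast
  have "strain u p = symm M" by (rule strain_affine[OF _ p]) (rule ua)
  then have M: "symm M = 0" using zero[OF T p] by simp
  have "u x = a + M *v x" if x: "x \<in> closure \<Omega>" for x
  proof -
    define w where "w = u x - (a + M *v x)"
    have orth: "w \<bullet> (x - y) = 0" if y: "y \<in> T" for y
    proof -
      have "w \<bullet> (x - y) = (u x - u y) \<bullet> (x - y) - (M *v (x - y)) \<bullet> (x - y)"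
        using ua[OF y] by (simp add: w_def inner_diff_left inner_add_left matrix_vector_mult_diff_distrib)
      also have "(u x - u y) \<bullet> (x - y) = 0"
        by (rule strain_zero_orthogonal[OF u _ x]) (use zero y triangle_subset[OF T] in auto)
      also have "(M *v (x - y)) \<bullet> (x - y) = 0"
        using M symm_quadratic[of "x - y" M] by (simp add: inner_commute)
      finally show ?thesis by simp
    qed
    obtain e where e: "0 < e" "cball p e \<subseteq> T" using p by (meson mem_interior_cball)
    have "w = 0"
    proof (rule ccontr)
      assume "w \<noteq> 0"
      define y where "y = p + (e / norm w) *\<^sub>R w"
      have "y \<in> T" using e \<open>w \<noteq> 0\<close> by (auto simp: y_def dist_norm subset_iff)
      moreover have "p \<in> T" using p interior_subset by blast
      ultimately have "w \<bullet> (y - p) = 0"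
        using orth[of y] orth[of p] by (simp add: inner_diff_right)
      then show False using e \<open>w \<noteq> 0\<close> by (simp add: y_def)
    qed
    then show ?thesis by (simp add: w_def)
  qed
  moreover have "(\<lambda>x. a + M *v x) \<in> rigid_modes"
    unfolding skew_mult[OF M] by (rule rigid_modesI)
  ultimately show ?thesis using that by blast
qed

text \<open>Rigid modes are functions on the plane, whereas finite element functions vanish outside the
  closed domain.\<close>
definition zero_ext :: "(real^2 \<Rightarrow> real^2) \<Rightarrow> real^2 \<Rightarrow> real^2" where
  "zero_ext v x = (if x \<in> closure \<Omega> then v x else 0)"

lemma rigid_in_V1_vec:
  assumes "v \<in> rigid_modes"
  shows "zero_ext v \<in> V1_vec \<Omega> \<T>"
proof (rule V1_vec_of_affine)
  fix T assume "T \<in> \<T>"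
  then have "\<forall>x\<in>T. zero_ext v x = v x" using triangle_subset by (auto simp: zero_ext_def)
  moreover obtain a b where "v = (\<lambda>x. a + b *\<^sub>R vector [- (x $ 2), x $ 1])"
    using assms by (auto simp: rigid_modes_def)
  ultimately show "\<exists>a M. \<forall>x\<in>T. zero_ext v x = a + M *v x"
    unfolding rot_mult by auto
qed (simp add: zero_ext_def)

text \<open>As rotations are orthogonal to the position vector, \<open>u \<bullet> x\<close> is affine for a rigid \<open>u\<close>, and
  its interpolation error vanishes.\<close>
lemma Pi_G_rigid:
  assumes v: "v \<in> rigid_modes"
  shows "Pi_G \<Omega> \<T> (zero_ext v) = 0"
proof -
  obtain a b where ab: "v = (\<lambda>x. a + b *\<^sub>R vector [- (x $ 2), x $ 1])"
    using assms by (auto simp: rigid_modes_def)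
  have eq: "zero_ext v x \<bullet> x = (if x \<in> closure \<Omega> then a \<bullet> x else 0)" for x
    using rot_orthogonal[of x] by (simp add: zero_ext_def ab inner_add_left)
  have "continuous_on (closure \<Omega>) (\<lambda>x. a \<bullet> x)" by (intro continuous_intros)
  then have "continuous_on (closure \<Omega>) (\<lambda>x. zero_ext v x \<bullet> x)"
    by (simp add: eq cong: continuous_on_cong)
  moreover have "\<exists>\<alpha> \<beta>. \<forall>x\<in>T. zero_ext v x \<bullet> x = \<alpha> + \<beta> \<bullet> x" if "T \<in> \<T>" for T
    using triangle_subset[OF that] by (intro exI[of _ 0] exI[of _ a]) (auto simp: eq)
  ultimately have "(\<lambda>x. zero_ext v x \<bullet> x) \<in> V1 \<Omega> \<T>" by (simp add: V1_def zero_ext_def)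
  then have "interp (\<lambda>x. zero_ext v x \<bullet> x) = (\<lambda>x. zero_ext v x \<bullet> x)" by (rule interp_V1)
  then show ?thesis
    by (simp add: fun_eq_iff Pi_G_eq[OF rigid_in_V1_vec[OF v]])
qed

lemma subspace_rigid: "subspace (zero_ext ` rigid_modes)"
proof (rule subspaceI)
  have "0 = zero_ext (\<lambda>x. 0 + 0 *\<^sub>R vector [- (x $ 2), x $ 1])" by (auto simp: zero_ext_def fun_eq_iff)
  then show "0 \<in> zero_ext ` rigid_modes" by (rule image_eqI[OF _ rigid_modesI])
next
  fix u v assume "u \<in> zero_ext ` rigid_modes" "v \<in> zero_ext ` rigid_modes"
  then obtain a b a' b' where
    "u = zero_ext (\<lambda>x. a + b *\<^sub>R vector [- (x $ 2), x $ 1])"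
    "v = zero_ext (\<lambda>x. a' + b' *\<^sub>R vector [- (x $ 2), x $ 1])"
    unfolding rigid_modes_def by blast
  then have "u + v = zero_ext (\<lambda>x. (a + a') + (b + b') *\<^sub>R vector [- (x $ 2), x $ 1])"
    by (auto simp: zero_ext_def fun_eq_iff scaleR_left_distrib)
  then show "u + v \<in> zero_ext ` rigid_modes" by (rule image_eqI[OF _ rigid_modesI])
next
  fix c u assume "u \<in> zero_ext ` rigid_modes"
  then obtain a b where "u = zero_ext (\<lambda>x. a + b *\<^sub>R vector [- (x $ 2), x $ 1])"
    unfolding rigid_modes_def by blast
  then have "c *\<^sub>R u = zero_ext (\<lambda>x. c *\<^sub>R a + (c * b) *\<^sub>R vector [- (x $ 2), x $ 1])"
    by (auto simp: zero_ext_def fun_eq_iff scaleR_right_distrib)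
  then show "c *\<^sub>R u \<in> zero_ext ` rigid_modes" by (rule image_eqI[OF _ rigid_modesI])
qed

definition l2 :: "(real^2 \<Rightarrow> real^2) \<Rightarrow> (real^2 \<Rightarrow> real^2) \<Rightarrow> real" where
  "l2 u v = (LINT x:\<Omega>|lebesgue. u x \<bullet> v x)"

lemma piecewise_V1_vec: "u \<in> V1_vec \<Omega> \<T> \<Longrightarrow> piecewise u"
  by (intro piecewise_continuous V1_vec_continuous)

lemma V1_vec_finite_dim: "\<exists>B. finite B \<and> V1_vec \<Omega> \<T> \<subseteq> span B"
proof -
  define e where "e = (\<lambda>(p, k) x. nodal_basis \<Omega> \<T> p x *\<^sub>R (axis k 1 :: real^2))"
  let ?I = "vertices \<T> \<times> (UNIV :: 2 set)"
  have "u \<in> span (e ` ?I)" if u: "u \<in> V1_vec \<Omega> \<T>" for u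
  proof -
    have "u x $ k = (\<Sum>i\<in>?I. (u (fst i) $ snd i) *\<^sub>R e i) x $ k" for x k
    proof -
      have "(\<Sum>i\<in>?I. (u (fst i) $ snd i) *\<^sub>R e i) x $ k
          = (\<Sum>p\<in>vertices \<T>. \<Sum>j\<in>UNIV. u p $ j * (nodal_basis \<Omega> \<T> p x * axis j 1 $ k))"
        by (simp add: sum_fun_apply sum.cartesian_product e_def split_def mult.assoc)
      also have "\<dots> = (\<Sum>p\<in>vertices \<T>. u p $ k * nodal_basis \<Omega> \<T> p x)"
        by (intro sum.cong refl) (simp add: axis_def if_distrib cong: if_cong)
      also have "\<dots> = u x $ k"
        using interp_V1[OF V1_vec_V1[OF u, of k]] by (simp add: interp_apply fun_eq_iff)
      finally show ?thesis by simp
    qed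
    then have "u = (\<Sum>i\<in>?I. (u (fst i) $ snd i) *\<^sub>R e i)"
      unfolding fun_eq_iff vec_eq_iff by blast
    also have "\<dots> \<in> span (e ` ?I)" by (intro span_sum span_scale span_base) auto
    finally show ?thesis .
  qed
  then have "V1_vec \<Omega> \<T> \<subseteq> span (e ` ?I)" by blast
  moreover have "finite (e ` ?I)" using finite_vertices by (intro finite_imageI finite_cartesian_product) auto
  ultimately show ?thesis by blast
qed

lemma l2_nonneg: "0 \<le> l2 u u"
  unfolding l2_def set_lebesgue_integral_def by (intro Bochner_Integration.integral_nonneg) simp

lemma l2_zero:
  assumes u: "u \<in> V1_vec \<Omega> \<T>" and "l2 u u = 0"
  shows "u = 0"
proof
  fix x
  have "u x \<bullet> u x = 0" if "T \<in> \<T>" "x \<in> interior T" for T x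
    using piecewise_inner[OF piecewise_V1_vec[OF u] piecewise_V1_vec[OF u]] _ _ that
    by (rule piecewise_integral_zero) (use assms in \<open>auto simp: l2_def\<close>)
  then have "u x = 0" if "x \<in> closure \<Omega>"
    using continuous_zero_on_mesh[OF V1_vec_continuous[OF u] _ that] by simp
  then show "u x = 0 x" using V1_vec_outside[OF u] by auto
qed

lemma l2_inner: "finite_dim_inner_on (V1_vec \<Omega> \<T>) l2"
proof
  show "l2 (u + v) w = l2 u w + l2 v w"
    if "u \<in> V1_vec \<Omega> \<T>" "v \<in> V1_vec \<Omega> \<T>" "w \<in> V1_vec \<Omega> \<T>" for u v w
    unfolding l2_def using that
    by (intro integral_piecewise_add piecewise_inner piecewise_V1_vec) (auto simp: inner_add_left)
  show "l2 (c *\<^sub>R u) w = c * l2 u w" if "u \<in> V1_vec \<Omega> \<T>" "w \<in> V1_vec \<Omega> \<T>" for c u w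
    unfolding l2_def using that by (intro integral_piecewise_scale piecewise_inner piecewise_V1_vec) auto
  show "l2 u v = l2 v u" for u v by (simp add: l2_def inner_commute)
  show "0 < l2 u u" if "u \<in> V1_vec \<Omega> \<T>" "u \<noteq> 0" for u
    using l2_zero[OF that(1)] that(2) l2_nonneg[of u] by fastforce
qed (use subspace_V1_vec V1_vec_finite_dim in auto)

lemma l2_zero_ext: "l2 u (zero_ext v) = (LINT x:\<Omega>|lebesgue. u x \<bullet> v x)"
  unfolding l2_def set_lebesgue_integral_def
  using closure_subset[of \<Omega>] by (intro Bochner_Integration.integral_cong) (auto simp: zero_ext_def indicator_def)

lemma W_perp_iff:
  "u \<in> W_perp \<Omega> \<T> \<longleftrightarrow> u \<in> V1_vec \<Omega> \<T> \<and> (\<forall>v\<in>rigid_modes. l2 u (zero_ext v) = 0)"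
  by (simp add: W_perp_def l2_zero_ext)

lemma W_perp_V1_vec: "u \<in> W_perp \<Omega> \<T> \<Longrightarrow> u \<in> V1_vec \<Omega> \<T>"
  by (simp add: W_perp_iff)

lemma subspace_W: "subspace (W_perp \<Omega> \<T>)"
proof -
  interpret L: finite_dim_inner_on "V1_vec \<Omega> \<T>" l2 by (rule l2_inner)
  show ?thesis
  proof (rule subspaceI)
    show "0 \<in> W_perp \<Omega> \<T>"
      using subspace_0[OF subspace_V1_vec] by (simp add: W_perp_iff L.zero rigid_in_V1_vec)
    show "u + v \<in> W_perp \<Omega> \<T>" if "u \<in> W_perp \<Omega> \<T>" "v \<in> W_perp \<Omega> \<T>" for u v
      using that subspace_add[OF subspace_V1_vec, of u v]
      by (simp add: W_perp_iff L.add rigid_in_V1_vec)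
    show "c *\<^sub>R u \<in> W_perp \<Omega> \<T>" if "u \<in> W_perp \<Omega> \<T>" for c u
      using that subspace_scale[OF subspace_V1_vec, of u c]
      by (simp add: W_perp_iff L.scale rigid_in_V1_vec)
  qed
qed

text \<open>The rigid part is the \<open>l2\<close>-orthogonal projection, the representer of \<open>\<lambda>v. l2 v u\<close> on the
  rigid modes.\<close>
lemma W_decomposition:
  assumes u: "u \<in> V1_vec \<Omega> \<T>"
  obtains w v where "w \<in> W_perp \<Omega> \<T>" "v \<in> rigid_modes" "u = w + zero_ext v"
proof -
  interpret L: finite_dim_inner_on "V1_vec \<Omega> \<T>" l2 by (rule l2_inner)
  interpret R: finite_dim_inner_on "zero_ext ` rigid_modes" l2
    using rigid_in_V1_vec by (intro finite_dim_inner_on_subspace[OF l2_inner subspace_rigid]) auto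
  have V: "x \<in> V1_vec \<Omega> \<T>" if "x \<in> zero_ext ` rigid_modes" for x using that rigid_in_V1_vec by blast
  obtain r where r: "r \<in> zero_ext ` rigid_modes" "\<And>v. v \<in> zero_ext ` rigid_modes \<Longrightarrow> l2 r v = l2 v u"
    by (rule R.riesz[of "\<lambda>v. l2 v u"]) (use V u in \<open>auto intro!: L.add L.scale\<close>)
  then obtain v where v: "v \<in> rigid_modes" "r = zero_ext v" by blast
  have "u - r \<in> V1_vec \<Omega> \<T>" using u V[OF r(1)] subspace_V1_vec by (simp add: subspace_diff)
  moreover have "l2 (u - r) (zero_ext v) = 0" if "v \<in> rigid_modes" for v
    using L.diff[OF u V[OF r(1)] rigid_in_V1_vec[OF that]] r(2)[of "zero_ext v"]
      L.sym[OF u rigid_in_V1_vec[OF that]] that by simp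
  ultimately have "u - r \<in> W_perp \<Omega> \<T>" by (simp add: W_perp_iff)
  then show ?thesis using that[of "u - r" v] v by simp
qed

end

section \<open>The preconditioned operator\<close>

context shape_regular_mesh
begin

abbreviation PiG where "PiG \<equiv> Pi_G \<Omega> \<T>"
abbreviation W where "W \<equiv> W_perp \<Omega> \<T>"

text \<open>The form \<open>a_G\<close> pulled back along \<open>\<Pi>\<close>: the inner product of \<open>W\<close> that
  represents the inverse of the preconditioner.\<close>
definition a_Pull :: "(real^2 \<Rightarrow> real^2) \<Rightarrow> (real^2 \<Rightarrow> real^2) \<Rightarrow> real" where
  "a_Pull u v = a_G \<Omega> (PiG u) (PiG v)"

lemma Pi_G_W_P2: "u \<in> W \<Longrightarrow> PiG u \<in> P2 \<Omega> \<T>"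
  by (intro Pi_G_P2 W_perp_V1_vec)

lemma a_Pull_pos:
  assumes u: "u \<in> W" and "u \<noteq> 0"
  shows "0 < a_Pull u u"
proof (rule ccontr)
  have u1: "u \<in> V1_vec \<Omega> \<T>" using u by (rule W_perp_V1_vec)
  assume "\<not> 0 < a_Pull u u"
  then have "a_Pull u u = 0" using a_G_nonneg[of "PiG u"] unfolding a_Pull_def by linarith
  then have "a_W \<Omega> u u \<le> 0" using a_W_le_a_G[OF u1] by (simp add: a_Pull_def)
  moreover have "0 \<le> a_W \<Omega> u u"
    unfolding a_W_eq set_lebesgue_integral_def by (intro Bochner_Integration.integral_nonneg) simp
  ultimately have zero: "a_W \<Omega> u u = 0" by simp
  have strain0: "strain u x = 0" if "T \<in> \<T>" "x \<in> interior T" for T x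
  proof -
    have "strain u x \<bullet> strain u x = 0"
      using piecewise_inner[OF piecewise_strain[OF u1] piecewise_strain[OF u1]] _ _ that
      by (rule piecewise_integral_zero) (use zero in \<open>auto simp: a_W_eq\<close>)
    then show ?thesis by simp
  qed
  obtain v where v: "v \<in> rigid_modes" "\<And>x. x \<in> closure \<Omega> \<Longrightarrow> u x = v x"
    by (rule strain_zero_rigid[OF u1]) (blast intro: strain0 that)+
  have "u = zero_ext v" using v(2) V1_vec_outside[OF u1] by (auto simp: zero_ext_def fun_eq_iff)
  then have "l2 u u = 0" using u v(1) by (simp add: W_perp_iff)
  then show False using l2_zero[OF u1] \<open>u \<noteq> 0\<close> by blast
qed

lemma a_Pull_inner: "finite_dim_inner_on W a_Pull"
proof
  show "subspace W" by (rule subspace_W)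
  show "a_Pull (u + v) w = a_Pull u w + a_Pull v w" if "u \<in> W" "v \<in> W" "w \<in> W" for u v w
    using that by (simp add: a_Pull_def Pi_G_add W_perp_V1_vec a_G_add Pi_G_W_P2)
  show "a_Pull (c *\<^sub>R u) w = c * a_Pull u w" if "u \<in> W" "w \<in> W" for c u w
    using that by (simp add: a_Pull_def Pi_G_scale W_perp_V1_vec a_G_scale Pi_G_W_P2)
  show "a_Pull u v = a_Pull v u" for u v by (simp add: a_Pull_def a_G_sym)
  show "0 < a_Pull u u" if "u \<in> W" "u \<noteq> 0" for u using that by (rule a_Pull_pos)
  show "\<exists>B. finite B \<and> W \<subseteq> span B"
    using V1_vec_finite_dim W_perp_V1_vec by (meson subsetI subset_trans)
qed

sublocale B: finite_dim_inner_on W a_Pull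
  by (rule a_Pull_inner)

lemma inj_Pi_G: "inj_on PiG W"
proof (rule inj_onI)
  fix u v assume "u \<in> W" "v \<in> W" "PiG u = PiG v"
  then show "u = v" by (intro B.unique) (auto simp: a_Pull_def)
qed

lemma V_G_eq: "V_G \<Omega> \<T> = PiG ` W"
proof
  show "PiG ` W \<subseteq> V_G \<Omega> \<T>" using W_perp_V1_vec by (auto simp: V_G_def)
  show "V_G \<Omega> \<T> \<subseteq> PiG ` W"
  proof
    fix f assume "f \<in> V_G \<Omega> \<T>"
    then obtain u where u: "u \<in> V1_vec \<Omega> \<T>" "f = PiG u" by (auto simp: V_G_def)
    obtain w v where wv: "w \<in> W" "v \<in> rigid_modes" "u = w + zero_ext v"
      using W_decomposition[OF u(1)] by blast
    then have "f = PiG w"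
      using u Pi_G_add[OF W_perp_V1_vec[OF wv(1)] rigid_in_V1_vec[OF wv(2)]] Pi_G_rigid[OF wv(2)]
      by simp
    then show "f \<in> PiG ` W" using wv by blast
  qed
qed

lemma equiv_mod_const: "equiv (P2 \<Omega> \<T>) (mod_const \<Omega> \<T>)"
proof (rule equivI)
  show "mod_const \<Omega> \<T> \<subseteq> P2 \<Omega> \<T> \<times> P2 \<Omega> \<T>" by (auto simp: mod_const_def)
  show "refl_on (P2 \<Omega> \<T>) (mod_const \<Omega> \<T>)"
    by (auto simp: refl_on_def mod_const_def intro: exI[of _ 0])
  show "sym (mod_const \<Omega> \<T>)"
  proof (rule symI)
    fix f g assume "(f, g) \<in> mod_const \<Omega> \<T>"
    then obtain c where "f \<in> P2 \<Omega> \<T>" "g \<in> P2 \<Omega> \<T>" "\<forall>x\<in>closure \<Omega>. g x = f x + c"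
      by (auto simp: mod_const_def)
    then show "(g, f) \<in> mod_const \<Omega> \<T>" by (auto simp: mod_const_def intro!: exI[of _ "- c"])
  qed
  show "trans (mod_const \<Omega> \<T>)"
  proof (rule transI)
    fix f g k assume fg: "(f, g) \<in> mod_const \<Omega> \<T>" and gk: "(g, k) \<in> mod_const \<Omega> \<T>"
    from fg obtain c where "f \<in> P2 \<Omega> \<T>" "\<forall>x\<in>closure \<Omega>. g x = f x + c"
      by (auto simp: mod_const_def)
    moreover from gk obtain d where "k \<in> P2 \<Omega> \<T>" "\<forall>x\<in>closure \<Omega>. k x = g x + d"
      by (auto simp: mod_const_def)
    ultimately show "(f, k) \<in> mod_const \<Omega> \<T>" by (auto simp: mod_const_def intro!: exI[of _ "c + d"])
  qed
qed

abbreviation qclass where "qclass f \<equiv> mod_const \<Omega> \<T> `` {f}"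

lemma qclass_V_q: "f \<in> P2 \<Omega> \<T> \<Longrightarrow> qclass f \<in> V_q \<Omega> \<T>"
  by (simp add: V_q_def quotientI)

lemma V_q_cases:
  assumes "X \<in> V_q \<Omega> \<T>"
  obtains f where "f \<in> P2 \<Omega> \<T>" "X = qclass f"
  using assms unfolding V_q_def by (rule quotientE)

lemma grad_mod_const:
  assumes "(f, g) \<in> mod_const \<Omega> \<T>" "T \<in> \<T>" "x \<in> interior T"
  shows "grad g x = grad f x"
proof -
  obtain c where f: "f \<in> P2 \<Omega> \<T>" and c: "\<And>y. y \<in> closure \<Omega> \<Longrightarrow> g y = f y + c"
    using assms(1) by (auto simp: mod_const_def)
  have "((\<lambda>y. f y + c) has_derivative (\<lambda>d. grad f x \<bullet> d)) (at x)"
    using has_derivative_add[OF has_derivative_grad[OF P2_differentiable[OF f assms(2,3)]] has_derivative_const]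
    by simp
  then have "(g has_derivative (\<lambda>d. grad f x \<bullet> d)) (at x)"
    using open_interior assms(3)
    by (rule has_derivative_transform_within_open)
       (use c triangle_subset[OF assms(2)] interior_subset[of T] in auto)
  then show ?thesis by (rule grad_eqI)
qed

text \<open>The chosen representatives of the classes differ from \<open>f\<close> and \<open>g\<close> by constants, which the
  gradient does not see.\<close>
lemma a_q_qclass:
  assumes f: "f \<in> P2 \<Omega> \<T>" and g: "g \<in> P2 \<Omega> \<T>"
  shows "a_q \<Omega> (qclass f) (qclass g) = a_G \<Omega> f g"
proof -
  have rep: "(k, SOME f. f \<in> qclass k) \<in> mod_const \<Omega> \<T>" if "k \<in> P2 \<Omega> \<T>" for k
  proof -
    have "k \<in> qclass k" using equiv_class_self[OF equiv_mod_const that] .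
    then have "(SOME f. f \<in> qclass k) \<in> qclass k" by (rule someI[of "\<lambda>g. g \<in> qclass k"])
    then show ?thesis by simp
  qed
  show ?thesis
    unfolding a_q_def a_G_def
  proof (rule integral_piecewise_cong[symmetric])
    show "piecewise (\<lambda>x. grad f x \<bullet> grad g x)"
      by (rule piecewise_inner[OF piecewise_grad[OF f] piecewise_grad[OF g]])
    fix T x assume "T \<in> \<T>" "x \<in> interior T"
    then show "grad f x \<bullet> grad g x = grad (SOME k. k \<in> qclass f) x \<bullet> grad (SOME k. k \<in> qclass g) x"
      by (simp only: grad_mod_const[OF rep[OF f]] grad_mod_const[OF rep[OF g]])
  qed
qed

lemma A_q_apply: "X \<in> V_q \<Omega> \<T> \<Longrightarrow> A_q \<Omega> \<T> U X = a_q \<Omega> U X"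
  by (simp add: A_q_def form_operator_def)

text \<open>If two classes induce the same functional, testing with their difference shows that it has zero
  energy; it is then constant, and the classes are equal.\<close>
lemma inj_A_q: "inj_on (A_q \<Omega> \<T>) (V_q \<Omega> \<T>)"
proof (rule inj_onI)
  fix X Y assume X: "X \<in> V_q \<Omega> \<T>" and Y: "Y \<in> V_q \<Omega> \<T>" and eq: "A_q \<Omega> \<T> X = A_q \<Omega> \<T> Y"
  obtain f where f: "f \<in> P2 \<Omega> \<T>" "X = qclass f" using V_q_cases[OF X] .
  obtain g where g: "g \<in> P2 \<Omega> \<T>" "Y = qclass g" using V_q_cases[OF Y] .
  let ?d = "g + (-1) *\<^sub>R f"
  have f': "(-1) *\<^sub>R f \<in> P2 \<Omega> \<T>" by (rule subspace_scale[OF subspace_P2 f(1)])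
  then have d: "?d \<in> P2 \<Omega> \<T>" by (rule subspace_add[OF subspace_P2 g(1)])
  have "a_G \<Omega> f ?d = a_G \<Omega> g ?d"
    using fun_cong[OF eq, of "qclass ?d"] A_q_apply[OF qclass_V_q[OF d]] a_q_qclass[OF _ d] f g by simp
  then have "a_G \<Omega> ?d ?d = 0"
    using a_G_add[OF g(1) f' d] a_G_scale[OF f(1) d, of "-1"] by simp
  then obtain c where c: "\<And>x. x \<in> closure \<Omega> \<Longrightarrow> ?d x = c" using a_G_zero[OF d] by blast
  then have "\<And>x. x \<in> closure \<Omega> \<Longrightarrow> g x = f x + c" by (simp add: algebra_simps)
  then have "(f, g) \<in> mod_const \<Omega> \<T>" using f g by (auto simp: mod_const_def)
  then show "X = Y" using f g equiv_class_eq[OF equiv_mod_const] by simp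
qed

text \<open>The adjoint of the inclusion sends the class of \<open>f\<close> to \<open>\<Pi> y\<close>, where \<open>y\<close> represents the
  functional \<open>\<lambda>w. a_G (\<Pi> w) f\<close> on \<open>W\<close>; injectivity of \<open>\<Pi>\<close> on \<open>W\<close> recovers \<open>y\<close>.\<close>
lemma Pi_tilde_qclass:
  assumes f: "f \<in> P2 \<Omega> \<T>"
  shows "Pi_tilde \<Omega> \<T> (qclass f) \<in> W"
    and "w \<in> W \<Longrightarrow> a_Pull (Pi_tilde \<Omega> \<T> (qclass f)) w = a_G \<Omega> (PiG w) f"
proof -
  obtain y where y: "y \<in> W" "\<And>w. w \<in> W \<Longrightarrow> a_Pull y w = a_G \<Omega> (PiG w) f"
    by (rule B.riesz[of "\<lambda>w. a_G \<Omega> (PiG w) f"])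
       (auto simp: Pi_G_add Pi_G_scale W_perp_V1_vec a_G_add a_G_scale Pi_G_W_P2 f)
  have adj: "(\<forall>u\<in>PiG ` W. a_q \<Omega> (Pi_q \<Omega> \<T> u) (qclass f) = a_G \<Omega> u (PiG z)) \<longleftrightarrow> z = y" if "z \<in> W" for z
  proof -
    have "(\<forall>u\<in>PiG ` W. a_q \<Omega> (Pi_q \<Omega> \<T> u) (qclass f) = a_G \<Omega> u (PiG z))
        \<longleftrightarrow> (\<forall>w\<in>W. a_Pull y w = a_Pull z w)"
      using y(2) by (simp add: Pi_q_def a_q_qclass[OF Pi_G_W_P2 f] a_Pull_def a_G_sym[of _ "PiG z"])
    then show ?thesis using B.unique[OF y(1) that] by metis
  qed
  have "Pi_q_adj \<Omega> \<T> (qclass f) = PiG y"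
    unfolding Pi_q_adj_def hilbert_adjoint_def V_G_eq
    by (rule the_equality) (use adj y(1) in auto)
  then have "Pi_tilde \<Omega> \<T> (qclass f) = y"
    using inj_Pi_G y(1) by (simp add: Pi_tilde_def)
  then show "Pi_tilde \<Omega> \<T> (qclass f) \<in> W"
    and "w \<in> W \<Longrightarrow> a_Pull (Pi_tilde \<Omega> \<T> (qclass f)) w = a_G \<Omega> (PiG w) f"
    using y by auto
qed

text \<open>Let \<open>z\<close> represent \<open>a u\<close> with respect to \<open>a_Pull\<close>. The class of \<open>\<Pi> z\<close> solves the quadratic
  problem whose right-hand side is the transpose of \<open>Pi_tilde\<close> applied to \<open>a u\<close>, and \<open>Pi_tilde\<close> maps
  it back to \<open>z\<close> since it inverts the inclusion of \<open>\<Pi> ` W\<close>.\<close>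
lemma precond_B:
  assumes add: "\<And>v w. \<lbrakk>v \<in> W; w \<in> W\<rbrakk> \<Longrightarrow> a u (v + w) = a u v + a u w"
    and scale: "\<And>c v. v \<in> W \<Longrightarrow> a u (c *\<^sub>R v) = c * a u v"
    and v: "v \<in> W"
  shows "a_Pull (precond_B \<Omega> \<T> (form_operator W a u)) v = a u v"
proof -
  obtain z where z: "z \<in> W" "\<And>w. w \<in> W \<Longrightarrow> a_Pull z w = a u w"
    by (rule B.riesz[of "a u"]) (auto simp: add scale)
  let ?g = "qclass (PiG z)"
  have g: "?g \<in> V_q \<Omega> \<T>" using z by (intro qclass_V_q Pi_G_W_P2)
  have "dual_map (V_q \<Omega> \<T>) (Pi_tilde \<Omega> \<T>) (form_operator W a u) = A_q \<Omega> \<T> ?g"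
  proof
    fix X
    show "dual_map (V_q \<Omega> \<T>) (Pi_tilde \<Omega> \<T>) (form_operator W a u) X = A_q \<Omega> \<T> ?g X"
    proof (cases "X \<in> V_q \<Omega> \<T>")
      case True
      then obtain f where f: "f \<in> P2 \<Omega> \<T>" "X = qclass f" by (rule V_q_cases)
      let ?y = "Pi_tilde \<Omega> \<T> X"
      have y: "?y \<in> W" "a_Pull ?y z = a_G \<Omega> (PiG z) f" using Pi_tilde_qclass[OF f(1)] z f(2) by auto
      have "a u ?y = a_Pull z ?y" using z y by simp
      also have "\<dots> = a_G \<Omega> (PiG z) f" using B.sym[OF z(1) y(1)] y(2) by simp
      also have "\<dots> = a_q \<Omega> ?g X" using a_q_qclass[OF Pi_G_W_P2[OF z(1)] f(1)] f(2) by simp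
      finally show ?thesis
        using True y(1) by (simp add: dual_map_def form_operator_def A_q_apply)
    qed (simp add: dual_map_def A_q_def form_operator_def)
  qed
  then have "precond_B \<Omega> \<T> (form_operator W a u) = Pi_tilde \<Omega> \<T> ?g"
    using inv_into_f_f[OF inj_A_q g] by (simp add: precond_B_def)
  moreover have "a_Pull (Pi_tilde \<Omega> \<T> ?g) v = a_G \<Omega> (PiG v) (PiG z)"
    using Pi_tilde_qclass(2)[OF Pi_G_W_P2[OF z(1)] v] .
  moreover have "\<dots> = a u v" using z v B.sym[OF z(1) v] by (simp add: a_Pull_def)
  ultimately show ?thesis by simp
qed

lemma condition_number_precond:
  assumes add: "\<And>u v w. \<lbrakk>u \<in> W; v \<in> W; w \<in> W\<rbrakk> \<Longrightarrow> a (u + v) w = a u w + a v w"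
    and scale: "\<And>c u w. \<lbrakk>u \<in> W; w \<in> W\<rbrakk> \<Longrightarrow> a (c *\<^sub>R u) w = c * a u w"
    and sym: "\<And>u v. a u v = a v u"
    and lower: "\<And>u. u \<in> W \<Longrightarrow> \<alpha> * a_W \<Omega> u u \<le> a u u"
    and upper: "\<And>u. u \<in> W \<Longrightarrow> a u u \<le> \<beta> * a_W \<Omega> u u"
    and "0 < \<alpha>" "0 \<le> \<beta>"
  shows "condition_number W (precond_B \<Omega> \<T> \<circ> form_operator W a)
    \<le> max \<bar>Max {} / Min {}\<bar> ((4 / \<rho> + 2)\<^sup>2 * (6400 / \<rho>^4) * (\<beta> / \<alpha>))"
proof -
  let ?C1 = "(4 / \<rho> + 2)\<^sup>2" and ?C2 = "6400 / \<rho>^4"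
  have "0 < 4 / \<rho> + 2" using rho_pos by (simp add: add_pos_pos)
  then have C: "0 < ?C1" "0 < ?C2" using rho_pos by simp_all
  have "condition_number W (precond_B \<Omega> \<T> \<circ> form_operator W a)
    \<le> max \<bar>Max {} / Min {}\<bar> ((\<beta> * ?C2) / (\<alpha> / ?C1))"
  proof (rule condition_number_le[OF a_Pull_inner])
    show "a_Pull ((precond_B \<Omega> \<T> \<circ> form_operator W a) u) v = a u v" if "u \<in> W" "v \<in> W" for u v
      using that by (simp, intro precond_B) (use add scale sym[of u] in auto)
    show "a u v = a v u" for u v by (rule sym)
    show "0 < \<alpha> / ?C1" using C \<open>0 < \<alpha>\<close> by simp
    fix u assume u: "u \<in> W"
    have "\<alpha> / ?C1 * a_Pull u u \<le> \<alpha> / ?C1 * (?C1 * a_W \<Omega> u u)"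
      using a_G_Pi_G_le[OF W_perp_V1_vec[OF u]] C \<open>0 < \<alpha>\<close>
      by (intro mult_left_mono) (auto simp: a_Pull_def)
    also have "\<dots> = \<alpha> * a_W \<Omega> u u" using C by simp
    finally show "\<alpha> / ?C1 * a_Pull u u \<le> a u u" using lower[OF u] by linarith
    have "\<beta> * a_W \<Omega> u u \<le> \<beta> * (?C2 * a_Pull u u)"
      using a_W_le_a_G[OF W_perp_V1_vec[OF u]] \<open>0 \<le> \<beta>\<close>
      by (intro mult_left_mono) (auto simp: a_Pull_def)
    then show "a u u \<le> \<beta> * ?C2 * a_Pull u u" using upper[OF u] by (simp add: mult.assoc)
  qed
  also have "(\<beta> * ?C2) / (\<alpha> / ?C1) = ?C1 * ?C2 * (\<beta> / \<alpha>)" by simp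
  finally show ?thesis .
qed

lemma condition_number_W:
  "condition_number W (precond_B \<Omega> \<T> \<circ> A_W \<Omega> \<T>)
    \<le> max \<bar>Max {} / Min {}\<bar> ((4 / \<rho> + 2)\<^sup>2 * (6400 / \<rho>^4))"
proof -
  have "condition_number W (precond_B \<Omega> \<T> \<circ> form_operator W (a_W \<Omega>))
    \<le> max \<bar>Max {} / Min {}\<bar> ((4 / \<rho> + 2)\<^sup>2 * (6400 / \<rho>^4) * (1 / 1))"
    by (rule condition_number_precond)
       (auto simp: a_W_add a_W_scale W_perp_V1_vec intro: a_W_sym)
  then show ?thesis by (simp add: A_W_def)
qed

lemma condition_number_LE:
  assumes mu: "0 < lame_mu E \<nu>" and lambda: "0 \<le> lame_lambda E \<nu>"
  shows "condition_number W (precond_B \<Omega> \<T> \<circ> A_LE \<Omega> \<T> E \<nu>)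
    \<le> max \<bar>Max {} / Min {}\<bar> ((4 / \<rho> + 2)\<^sup>2 * (6400 / \<rho>^4) * (1 + lame_lambda E \<nu> / lame_mu E \<nu>))"
proof -
  let ?m = "lame_mu E \<nu>" and ?l = "lame_lambda E \<nu>"
  have eq: "a_LE \<Omega> E \<nu> u v = 2 * ?m * a_W \<Omega> u v + ?l * a_div u v" if "u \<in> W" "v \<in> W" for u v
    using that by (intro a_LE_eq W_perp_V1_vec)
  have "condition_number W (precond_B \<Omega> \<T> \<circ> form_operator W (a_LE \<Omega> E \<nu>))
    \<le> max \<bar>Max {} / Min {}\<bar>
        ((4 / \<rho> + 2)\<^sup>2 * (6400 / \<rho>^4) * ((2 * ?m + 2 * ?l) / (2 * ?m)))"
  proof (rule condition_number_precond)
    show "a_LE \<Omega> E \<nu> (u + v) w = a_LE \<Omega> E \<nu> u w + a_LE \<Omega> E \<nu> v w"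
      if "u \<in> W" "v \<in> W" "w \<in> W" for u v w
      using that subspace_add[OF subspace_W that(1,2)]
      by (simp add: eq a_W_add a_div_add W_perp_V1_vec algebra_simps)
    show "a_LE \<Omega> E \<nu> (c *\<^sub>R u) w = c * a_LE \<Omega> E \<nu> u w" if "u \<in> W" "w \<in> W" for c u w
      using that subspace_scale[OF subspace_W that(1), of c]
      by (simp add: eq a_W_scale a_div_scale W_perp_V1_vec algebra_simps)
    show "a_LE \<Omega> E \<nu> u v = a_LE \<Omega> E \<nu> v u" for u v
      by (simp add: a_LE_def frobenius_inner inner_commute mult_ac)
    fix u assume u: "u \<in> W"
    have div: "0 \<le> a_div u u" "a_div u u \<le> 2 * a_W \<Omega> u u"
      using a_div_nonneg a_div_le[OF W_perp_V1_vec[OF u]] by auto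
    show "2 * ?m * a_W \<Omega> u u \<le> a_LE \<Omega> E \<nu> u u"
      using eq[OF u u] div(1) lambda by simp
    have "?l * a_div u u \<le> ?l * (2 * a_W \<Omega> u u)" using div(2) lambda by (rule mult_left_mono)
    then show "a_LE \<Omega> E \<nu> u u \<le> (2 * ?m + 2 * ?l) * a_W \<Omega> u u"
      using eq[OF u u] by (simp add: algebra_simps)
  qed (use mu lambda in auto)
  also have "(2 * ?m + 2 * ?l) / (2 * ?m) = 1 + ?l / ?m" using mu by (simp add: field_simps)
  finally show ?thesis unfolding A_LE_def .
qed

end

theorem mainTheorem5:
  fixes \<Omega> :: "(real^2) set" and F :: "(real^2) set set set"
  assumes "convex_polygonal_domain \<Omega>"
    and "quasi_uniform_family \<Omega> F"
  shows "(\<exists>C. \<forall>\<T>\<in>F. condition_number (W_perp \<Omega> \<T>) (precond_B \<Omega> \<T> \<circ> A_W \<Omega> \<T>) \<le> C) \<and>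
    (\<forall>E0>0. \<forall>\<Lambda>>0. \<exists>C. \<forall>\<T>\<in>F. \<forall>E \<nu>.
       E0 \<le> E \<and> 0 < \<nu> \<and> \<nu> < 1/2 \<and> \<Lambda> \<le> lame_lambda E \<nu> \<longrightarrow>
       condition_number (W_perp \<Omega> \<T>) (precond_B \<Omega> \<T> \<circ> A_LE \<Omega> \<T> E \<nu>) \<le> C * lame_lambda E \<nu>)"
proof -
  obtain \<rho> where \<rho>: "0 < \<rho>" "\<forall>\<T>\<in>F. \<forall>T\<in>\<T>. \<exists>x. ball x (\<rho> * mesh_size \<T>) \<subseteq> T"
    using assms(2) by (auto simp: quasi_uniform_family_def)
  have mesh: "shape_regular_mesh \<Omega> \<T> \<rho>" if "\<T> \<in> F" for \<T>
    using that assms \<rho> by unfold_locales (auto simp: quasi_uniform_family_def)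
  define K0 :: real where "K0 = \<bar>Max {} / Min {}\<bar>"
  define K where "K = (4 / \<rho> + 2)\<^sup>2 * (6400 / \<rho>^4)"
  have nonneg: "0 \<le> K0" "0 \<le> K" using \<rho>(1) by (auto simp: K0_def K_def)
  show ?thesis
  proof (intro conjI allI impI)
    show "\<exists>C. \<forall>\<T>\<in>F. condition_number (W_perp \<Omega> \<T>) (precond_B \<Omega> \<T> \<circ> A_W \<Omega> \<T>) \<le> C"
      using shape_regular_mesh.condition_number_W[OF mesh] by blast
  next
    fix E0 \<Lambda> :: real
    assume E0: "0 < E0" and \<Lambda>: "0 < \<Lambda>"
    show "\<exists>C. \<forall>\<T>\<in>F. \<forall>E \<nu>. E0 \<le> E \<and> 0 < \<nu> \<and> \<nu> < 1/2 \<and> \<Lambda> \<le> lame_lambda E \<nu> \<longrightarrow>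
       condition_number (W_perp \<Omega> \<T>) (precond_B \<Omega> \<T> \<circ> A_LE \<Omega> \<T> E \<nu>) \<le> C * lame_lambda E \<nu>"
    proof (intro exI ballI allI impI)
      fix \<T> E \<nu>
      assume \<T>: "\<T> \<in> F" and *: "E0 \<le> E \<and> 0 < \<nu> \<and> \<nu> < 1/2 \<and> \<Lambda> \<le> lame_lambda E \<nu>"
      let ?l = "lame_lambda E \<nu>"
      interpret shape_regular_mesh \<Omega> \<T> \<rho> using \<T> by (rule mesh)
      have \<lambda>: "\<Lambda> \<le> ?l" "0 < ?l" using * \<Lambda> by auto
      have E: "0 < E" "E0 \<le> E" using * E0 by auto
      have \<mu>: "0 < lame_mu E \<nu>" using * E by (simp add: lame_mu_def)
      \<comment> \<open>\<open>1 / \<mu> = 2 (1 + \<nu>) / E\<close> is bounded, and \<open>1 \<le> \<lambda> / \<Lambda>\<close>: so \<open>1 + \<lambda> / \<mu>\<close> is of order \<open>\<lambda>\<close>\<close>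
      have "1 / lame_mu E \<nu> \<le> 3 / E0"
      proof -
        have "1 / lame_mu E \<nu> = 2 * (1 + \<nu>) / E" by (simp add: lame_mu_def)
        also have "\<dots> \<le> 3 / E0" using * E E0 by (intro frac_le) auto
        finally show ?thesis .
      qed
      then have "1 + ?l / lame_mu E \<nu> \<le> ?l / \<Lambda> + 3 / E0 * ?l"
        using \<lambda> \<Lambda> mult_right_mono[of "1 / lame_mu E \<nu>" "3 / E0" ?l]
        by (intro add_mono) (auto simp: field_simps)
      then have "K * (1 + ?l / lame_mu E \<nu>) \<le> K * (1 / \<Lambda> + 3 / E0) * ?l"
        using nonneg(2) mult_left_mono by (fastforce simp: algebra_simps)
      moreover have "K0 \<le> K0 / \<Lambda> * ?l"
        using nonneg(1) \<lambda> \<Lambda> by (simp add: field_simps mult_left_mono)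
      moreover have "condition_number W (precond_B \<Omega> \<T> \<circ> A_LE \<Omega> \<T> E \<nu>)
          \<le> max K0 (K * (1 + ?l / lame_mu E \<nu>))"
        using condition_number_LE[OF \<mu>] \<lambda> by (simp add: K0_def K_def)
      ultimately show "condition_number W (precond_B \<Omega> \<T> \<circ> A_LE \<Omega> \<T> E \<nu>)
          \<le> max (K0 / \<Lambda>) (K * (1 / \<Lambda> + 3 / E0)) * ?l"
        using \<lambda>(2) by (auto simp: max_mult_distrib_right)
    qed
  qed
qed

end
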